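(* Let $(n,d)=(n_k,d_k)$ be any sequence with $n\to\infty$ and $d\to\infty$, let the samples satisfy assumptions A1 and A2 of the context, and let the bandwidth of the Gaussian kernel satisfy $\gamma=\Omega(\sqrt d)$. Fix $\alpha\in(0,1)$, and consider the test which rejects $H_0:\mu_P=\mu_Q$ if and only if $\sqrt n\,\mathrm{MMD}^2_l/\sqrt v>z_\alpha$. Suppose the signal to noise ratio $\Psi=\|\delta\|/\sigma$ satisfies $\Psi=\omega(d^{1/2})$ (i.e. $\Psi/d^{1/2}\to\infty$). Then the power goes to $1$ at the rate of $\Phi(\sqrt n\,\Psi)$, independent of $d$, in the sense that there are constants $0<c\le C<\infty$ and numbers $c_k\in[c,C]$ such that $$\Pr(\text{reject }H_0)-\Phi\left(c_k\sqrt n\,\Psi-z_\alpha\right)\to0;$$ in particular the power tends to $1$.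
   Context: All quantities may depend on the index $k$ of the sequence $(n,d)=(n_k,d_k)$, which is suppressed; $n$ is even. Assumption A1: the data are $x_i=Us_i+\mu_P\in\mathbb R^d$ (samples from $P$) and $y_i=Ut_i+\mu_Q\in\mathbb R^d$ (samples from $Q$), $i=1,\dots,n$, where $U$ is a $d\times d$ orthogonal matrix ($UU^T=I$), $\mu_P,\mu_Q\in\mathbb R^d$, and $s_1,\dots,s_n,t_1,\dots,t_n$ are i.i.d. random vectors, each having $d$ i.i.d. zero-mean coordinates with a common law on $\mathbb R$ not depending on $(n,d)$. Assumption A2: the $k$-th central moments of each coordinate of $s_i,t_i$ exist (are finite) for $2\le k\le 6$. The variance of each coordinate is $\sigma^2>0$. Notation: $\delta:=\mu_P-\mu_Q$; $\|\cdot\|$ is the Euclidean norm; the signal to noise ratio is $\Psi:=\|\delta\|/\sigma$; $\Phi$ is the standard normal cdf and $z_\alpha$ its $(1-\alpha)$ quantile. $\gamma=\Omega(\sqrt d)$ means there is a constant $c'>0$ with $\gamma\ge c'\sqrt d$ along the sequence. The Gaussian kernel is $k(x,y)=\exp(-\|x-y\|^2/\gamma^2)$. With $z_i=(x_i,y_i)$, let $$h(z_i,z_j)=k(x_i,x_j)+k(y_i,y_j)-k(x_i,y_j)-k(x_j,y_i),\qquad \mathrm{MMD}^2_l=\frac1{n/2}\sum_{i=1}^{n/2}h(z_{2i-1},z_{2i}).$$ $v$ is twice the empirical variance of the $n/2$ values $h(z_{2i-1},z_{2i})$, i.e. $v=2\cdot\frac{1}{n/2}\sum_{i=1}^{n/2}\big(h(z_{2i-1},z_{2i})-\mathrm{MMD}^2_l\big)^2$.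 The power is the rejection probability when $\delta\ne0$. *)

theory Defs
  imports "HOL-Probability.Probability"
begin

text \<open>
  The dimension varies along the sequence, so a vector of \<open>\<real>\<^sup>d\<close> is a function \<open>nat \<Rightarrow> real\<close> of which
  only the values at \<open>{..<d}\<close> matter, and a \<open>d \<times> d\<close> matrix is a function \<open>nat \<Rightarrow> nat \<Rightarrow> real\<close> of which
  only the entries with both indices in \<open>{..<d}\<close> matter. Samples are indexed from \<open>1\<close>.
\<close>

definition euclidean_norm :: "nat \<Rightarrow> (nat \<Rightarrow> real) \<Rightarrow> real" where
  "euclidean_norm d v = L2_set v {..<d}"

definition mat_vec :: "nat \<Rightarrow> (nat \<Rightarrow> nat \<Rightarrow> real) \<Rightarrow> (nat \<Rightarrow> real) \<Rightarrow> nat \<Rightarrow> real" where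
  "mat_vec d U v a = (\<Sum>b<d. U a b * v b)"

definition orthogonal_upto :: "nat \<Rightarrow> (nat \<Rightarrow> nat \<Rightarrow> real) \<Rightarrow> bool" where
  "orthogonal_upto d U \<longleftrightarrow>
     (\<forall>a<d. \<forall>b<d. (\<Sum>l<d. U a l * U b l) = (if a = b then 1 else 0))"

definition iid_vars :: "'w measure \<Rightarrow> 'b measure \<Rightarrow> ('i \<Rightarrow> 'w \<Rightarrow> 'b) \<Rightarrow> 'i set \<Rightarrow> bool" where
  "iid_vars M N X I \<longleftrightarrow>
     prob_space.indep_vars M (\<lambda>_. N) X I \<and> (\<forall>i\<in>I. \<forall>j\<in>I. distr M N (X i) = distr M N (X j))"

text \<open>
  \<open>L\<close> is the common law of the coordinates. The \<open>2 n\<close> latent vectors \<open>s 1, \<dots>, s n, t 1, \<dots>, t n\<close> form one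
  family indexed by a disjoint sum. They are restricted to \<open>{..<d}\<close> because the elements of
  \<open>\<Pi>\<^sub>M b\<in>{..<d}. borel\<close> are functions that are \<open>undefined\<close> elsewhere.
\<close>

definition location_model ::
  "real measure \<Rightarrow> 'w measure \<Rightarrow> nat \<Rightarrow> nat \<Rightarrow> (nat \<Rightarrow> nat \<Rightarrow> real) \<Rightarrow> (nat \<Rightarrow> real) \<Rightarrow> (nat \<Rightarrow> real) \<Rightarrow>
   (nat \<Rightarrow> 'w \<Rightarrow> nat \<Rightarrow> real) \<Rightarrow> (nat \<Rightarrow> 'w \<Rightarrow> nat \<Rightarrow> real) \<Rightarrow>
   (nat \<Rightarrow> 'w \<Rightarrow> nat \<Rightarrow> real) \<Rightarrow> (nat \<Rightarrow> 'w \<Rightarrow> nat \<Rightarrow> real) \<Rightarrow> bool" where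
  "location_model L M n d U \<mu>P \<mu>Q s t x y \<longleftrightarrow>
     prob_space M \<and> orthogonal_upto d U \<and>
     iid_vars M (\<Pi>\<^sub>M b\<in>{..<d}. borel) (\<lambda>u \<omega>. restrict (case_sum s t u \<omega>) {..<d}) ({1..n} <+> {1..n}) \<and>
     (\<forall>u\<in>{1..n} <+> {1..n}.
        iid_vars M borel (\<lambda>b \<omega>. case_sum s t u \<omega> b) {..<d} \<and>
        (\<forall>b<d. distr M borel (\<lambda>\<omega>. case_sum s t u \<omega> b) = L)) \<and>
     (\<forall>i\<in>{1..n}. \<forall>\<omega>\<in>space M. \<forall>a<d.
        x i \<omega> a = mat_vec d U (s i \<omega>) a + \<mu>P a \<and>
        y i \<omega> a = mat_vec d U (t i \<omega>) a + \<mu>Q a)"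

definition zero_mean_law :: "real measure \<Rightarrow> bool" where
  "zero_mean_law L \<longleftrightarrow>
     prob_space L \<and> sets L = sets borel \<and> integrable L (\<lambda>x. x) \<and> prob_space.expectation L (\<lambda>x. x) = 0"

definition central_moments_2_to_6 :: "real measure \<Rightarrow> bool" where
  "central_moments_2_to_6 L \<longleftrightarrow>
     (\<forall>r\<in>{2..6::nat}. integrable L (\<lambda>x. (x - prob_space.expectation L (\<lambda>x. x)) ^ r))"

definition gauss_kernel :: "real \<Rightarrow> nat \<Rightarrow> (nat \<Rightarrow> real) \<Rightarrow> (nat \<Rightarrow> real) \<Rightarrow> real" where
  "gauss_kernel \<gamma> d x y = exp (- (euclidean_norm d (\<lambda>a. x a - y a))\<^sup>2 / \<gamma>\<^sup>2)"

definition mmd_h :: "('v \<Rightarrow> 'v \<Rightarrow> real) \<Rightarrow> 'v \<times> 'v \<Rightarrow> 'v \<times> 'v \<Rightarrow> real" where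
  "mmd_h K z z' =
     K (fst z) (fst z') + K (snd z) (snd z') - K (fst z) (snd z') - K (fst z') (snd z)"

definition linear_mmd :: "('v \<Rightarrow> 'v \<Rightarrow> real) \<Rightarrow> nat \<Rightarrow> (nat \<Rightarrow> 'v \<times> 'v) \<Rightarrow> real" where
  "linear_mmd K n z = 1 / (real n / 2) * (\<Sum>i = 1..n div 2. mmd_h K (z (2 * i - 1)) (z (2 * i)))"

definition linear_mmd_var :: "('v \<Rightarrow> 'v \<Rightarrow> real) \<Rightarrow> nat \<Rightarrow> (nat \<Rightarrow> 'v \<times> 'v) \<Rightarrow> real" where
  "linear_mmd_var K n z =
     2 * (1 / (real n / 2) *
       (\<Sum>i = 1..n div 2. (mmd_h K (z (2 * i - 1)) (z (2 * i)) - linear_mmd K n z)\<^sup>2))"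

definition std_normal_cdf :: "real \<Rightarrow> real" where
  "std_normal_cdf = cdf std_normal_distribution"

definition std_normal_quantile :: "real \<Rightarrow> real" where
  "std_normal_quantile p = Inf {z. p \<le> std_normal_cdf z}"

definition z_upper :: "real \<Rightarrow> real" where
  "z_upper \<alpha> = std_normal_quantile (1 - \<alpha>)"

text \<open>Where the variance estimate vanishes, the test statistic is \<open>0\<close>, since \<open>a / 0 = 0\<close>.\<close>

definition reject_prob ::
  "'w measure \<Rightarrow> nat \<Rightarrow> nat \<Rightarrow> real \<Rightarrow> real \<Rightarrow>
   (nat \<Rightarrow> 'w \<Rightarrow> nat \<Rightarrow> real) \<Rightarrow> (nat \<Rightarrow> 'w \<Rightarrow> nat \<Rightarrow> real) \<Rightarrow> real" where
  "reject_prob M n d \<gamma> \<alpha> x y =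
     measure M {\<omega> \<in> space M.
       sqrt (real n) * linear_mmd (gauss_kernel \<gamma> d) n (\<lambda>i. (x i \<omega>, y i \<omega>)) /
         sqrt (linear_mmd_var (gauss_kernel \<gamma> d) n (\<lambda>i. (x i \<omega>, y i \<omega>))) > z_upper \<alpha>}"

definition snr :: "nat \<Rightarrow> (nat \<Rightarrow> real) \<Rightarrow> (nat \<Rightarrow> real) \<Rightarrow> real \<Rightarrow> real" where
  "snr d \<mu>P \<mu>Q \<sigma> = euclidean_norm d (\<lambda>a. \<mu>P a - \<mu>Q a) / \<sigma>"

end

theory Submission
  imports Defs
begin

text \<open>
  Since \<open>\<Psi> \<rightarrow> \<infinity>\<close> and \<open>n \<ge> 1\<close> eventually, \<open>\<Phi> (\<surd>n \<Psi> - z\<^sub>\<alpha>) \<rightarrow> 1\<close>. So everything follows, with all \<open>c\<^sub>k = 1\<close>, once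
  the power itself is shown to tend to \<open>1\<close>. The statistic is the studentised mean of \<open>m = n / 2\<close> independent
  copies of \<open>h\<close>. Its rejection probability tends to \<open>1\<close> as soon as, uniformly along the sequence,
  the second moment of \<open>h\<close> is at most a constant times the square of its positive mean, and no single value of
  \<open>h\<close> has probability close to \<open>1\<close>. Chebyshev's and Markov's inequalities then bound the numerator from below
  and the variance estimate from above (\<open>prob_studentized_ratio_gt\<close>). The second condition is there because
  a vanishing variance estimate makes the statistic \<open>0\<close>, which is no rejection when \<open>z\<^sub>\<alpha> \<ge> 0\<close>.

  Write \<open>e = U\<^sup>T \<delta>\<close> and \<open>N = \<parallel>\<delta>\<parallel>\<^sup>2\<close>. Orthogonality of \<open>U\<close> turns the four kernel values in \<open>h\<close> into functions
  of the latent vectors, with exponents \<open>\<parallel>s - s'\<parallel>\<^sup>2\<close>, \<open>\<parallel>t - t'\<parallel>\<^sup>2\<close>, \<open>\<parallel>s - t' + e\<parallel>\<^sup>2\<close> and \<open>\<parallel>s' - t + e\<parallel>\<^sup>2\<close>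
  (\<open>mmd_h_rotated\<close>). All four differences have the same law, that of \<open>u - u'\<close>, so the mean of \<open>h\<close> is
  \<open>2 E (exp (- R / \<gamma>\<^sup>2) - exp (- (R + 2 X + N) / \<gamma>\<^sup>2))\<close> with \<open>R = \<parallel>u - u'\<parallel>\<^sup>2\<close> and \<open>X = \<langle>e, u - u'\<rangle>\<close>. Here \<open>R\<close> is of order
  \<open>d\<close>, hence at most of order \<open>\<gamma>\<^sup>2\<close>. The fluctuation of \<open>R\<close> is of order \<open>\<surd>d\<close> and \<open>X\<close> is of order \<open>\<surd>N\<close>; both are
  negligible against \<open>N\<close>, since \<open>\<Psi> = \<omega>(\<surd>d)\<close> says that \<open>N\<close> dominates \<open>d\<close>. It follows that with
  \<open>w = min 1 (N / \<gamma>\<^sup>2)\<close> the mean is at least a constant times \<open>w\<close> (\<open>Q_kernel_gap\<close>) and the second moment at most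
  a constant times \<open>w\<^sup>2\<close> (\<open>Q_kernel_fluctuation\<close>, \<open>latent_h_moments\<close>), however fast \<open>\<gamma>\<close> grows.

  The atoms are controlled without any limit theorem. If \<open>h\<close> is regarded as a function of one coordinate \<open>u\<close>
  of \<open>s\<close> and the same coordinate \<open>p\<close> of \<open>s'\<close>, only \<open>exp (- \<parallel>s - s'\<parallel>\<^sup>2 / \<gamma>\<^sup>2)\<close> depends on both, so the mixed second
  difference of \<open>h\<close> in \<open>(u, p)\<close> is that of a Gaussian in \<open>u - p\<close>. Given two short intervals
  that lie far apart, it is positive if each of \<open>u\<close> and \<open>p\<close> moves from the first to the second; suitable intervals
  have positive probability, and that probability does not depend on \<open>d\<close>, \<open>\<gamma>\<close> or \<open>\<delta>\<close>.
  Hence the probability that \<open>h\<close> differs from a given value is bounded below (\<open>latent_h_not_concentrated\<close>).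
\<close>

section \<open>Removing the rotation\<close>

lemma euclidean_norm_square: "(euclidean_norm d v)\<^sup>2 = (\<Sum>b<d. (v b)\<^sup>2)"
  by (simp add: euclidean_norm_def L2_set_def sum_nonneg)

lemma gauss_kernel_eq: "gauss_kernel \<gamma> d x y = exp (- (\<Sum>b<d. (x b - y b)\<^sup>2) / \<gamma>\<^sup>2)"
  by (simp add: gauss_kernel_def euclidean_norm_square)

lemma square_sum_eq_double_sum:
  fixes f :: "nat \<Rightarrow> real"
  shows "(\<Sum>a<d. f a)\<^sup>2 = (\<Sum>a<d. \<Sum>b<d. f a * f b)"
  by (simp add: power2_eq_square sum_product)

text \<open>
  The definition provides orthonormal rows. Put \<open>P = U\<^sup>T U\<close>. Since \<open>U U\<^sup>T = I\<close>, both the trace and the squared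
  Frobenius norm of \<open>P\<close> are \<open>d\<close>, so the squared Frobenius norm of \<open>P - I\<close> is \<open>d - 2 d + d = 0\<close>.
\<close>
lemma orthogonal_columns:
  assumes "orthogonal_upto d U" "b < d" "c < d"
  shows "(\<Sum>a<d. U a b * U a c) = (if b = c then 1 else 0)"
proof -
  have rows: "(\<Sum>l<d. U a l * U b l) = (if a = b then 1 else 0)" if "a < d" "b < d" for a b
    using assms(1) that by (auto simp: orthogonal_upto_def)
  define P where "P l m = (\<Sum>a<d. U a l * U a m)" for l m
  have trace: "(\<Sum>l<d. P l l) = real d"
  proof -
    have "(\<Sum>l<d. P l l) = (\<Sum>a<d. \<Sum>l<d. U a l * U a l)"
      unfolding P_def by (rule sum.swap)
    also have "\<dots> = (\<Sum>a<d. 1)"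
      by (intro sum.cong) (auto simp: rows)
    finally show ?thesis by simp
  qed
  have frob: "(\<Sum>l<d. \<Sum>m<d. (P l m)\<^sup>2) = real d"
  proof -
    have "(\<Sum>l<d. \<Sum>m<d. (P l m)\<^sup>2)
        = (\<Sum>l<d. \<Sum>m<d. \<Sum>a<d. \<Sum>b<d. (U a l * U b l) * (U a m * U b m))"
      unfolding P_def square_sum_eq_double_sum by (simp add: ac_simps)
    also have "\<dots> = (\<Sum>l<d. \<Sum>a<d. \<Sum>m<d. \<Sum>b<d. (U a l * U b l) * (U a m * U b m))"
      by (intro sum.cong refl sum.swap)
    also have "\<dots> = (\<Sum>a<d. \<Sum>l<d. \<Sum>m<d. \<Sum>b<d. (U a l * U b l) * (U a m * U b m))"
      by (rule sum.swap)
    also have "\<dots> = (\<Sum>a<d. \<Sum>l<d. \<Sum>b<d. \<Sum>m<d. (U a l * U b l) * (U a m * U b m))"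
      by (intro sum.cong refl sum.swap)
    also have "\<dots> = (\<Sum>a<d. \<Sum>b<d. \<Sum>l<d. \<Sum>m<d. (U a l * U b l) * (U a m * U b m))"
      by (intro sum.cong refl sum.swap)
    also have "\<dots> = (\<Sum>a<d. \<Sum>b<d. (\<Sum>l<d. U a l * U b l) * (\<Sum>m<d. U a m * U b m))"
      by (simp add: sum_product)
    also have "\<dots> = (\<Sum>a<d. \<Sum>b<d. if a = b then 1 else 0)"
      by (intro sum.cong refl) (auto simp: rows)
    finally show ?thesis by simp
  qed
  have "(\<Sum>l<d. \<Sum>m<d. (P l m - (if l = m then 1 else 0))\<^sup>2)
      = (\<Sum>l<d. \<Sum>m<d. (P l m)\<^sup>2 - 2 * (if l = m then P l m else 0) + (if l = m then 1 else 0))"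
    by (intro sum.cong refl) (auto simp: power2_eq_square algebra_simps)
  also have "\<dots> = (\<Sum>l<d. \<Sum>m<d. (P l m)\<^sup>2) - 2 * (\<Sum>l<d. P l l) + real d"
    by (simp add: sum.distrib sum_subtractf sum_distrib_left[symmetric])
  also have "\<dots> = 0"
    by (simp add: trace frob)
  finally have "(\<Sum>l<d. \<Sum>m<d. (P l m - (if l = m then 1 else 0))\<^sup>2) = 0" .
  then have "\<forall>l\<in>{..<d}. \<forall>m\<in>{..<d}. (P l m - (if l = m then 1 else 0))\<^sup>2 = 0"
    by (subst (asm) sum_nonneg_eq_0_iff; simp add: sum_nonneg sum_nonneg_eq_0_iff)
  then show ?thesis
    using assms(2,3) by (simp add: P_def)
qed

lemma orthogonal_norm:
  assumes "orthogonal_upto d U"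
  shows "(\<Sum>a<d. (mat_vec d U v a)\<^sup>2) = (\<Sum>b<d. (v b)\<^sup>2)"
proof -
  have "(\<Sum>a<d. (mat_vec d U v a)\<^sup>2)
      = (\<Sum>a<d. \<Sum>b<d. \<Sum>c<d. (U a b * U a c) * (v b * v c))"
    unfolding mat_vec_def square_sum_eq_double_sum by (simp add: ac_simps)
  also have "\<dots> = (\<Sum>b<d. \<Sum>a<d. \<Sum>c<d. (U a b * U a c) * (v b * v c))"
    by (rule sum.swap)
  also have "\<dots> = (\<Sum>b<d. \<Sum>c<d. \<Sum>a<d. (U a b * U a c) * (v b * v c))"
    by (intro sum.cong refl sum.swap)
  also have "\<dots> = (\<Sum>b<d. \<Sum>c<d. (\<Sum>a<d. U a b * U a c) * (v b * v c))"
    by (simp add: sum_distrib_right)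
  also have "\<dots> = (\<Sum>b<d. \<Sum>c<d. if b = c then (v b)\<^sup>2 else 0)"
    by (intro sum.cong refl) (auto simp: orthogonal_columns[OF assms] power2_eq_square)
  finally show ?thesis by simp
qed

lemma orthogonal_mat_vec_transpose:
  assumes "orthogonal_upto d U" "a < d"
  shows "mat_vec d U (\<lambda>b. \<Sum>c<d. U c b * v c) a = v a"
proof -
  have "mat_vec d U (\<lambda>b. \<Sum>c<d. U c b * v c) a = (\<Sum>b<d. \<Sum>c<d. U a b * U c b * v c)"
    by (simp add: mat_vec_def sum_distrib_left mult.assoc)
  also have "\<dots> = (\<Sum>c<d. (\<Sum>b<d. U a b * U c b) * v c)"
    by (subst sum.swap) (simp add: sum_distrib_right)
  also have "\<dots> = (\<Sum>c<d. if a = c then v c else 0)"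
    using assms by (intro sum.cong refl) (auto simp: orthogonal_upto_def)
  finally show ?thesis using assms(2) by simp
qed

lemma mat_vec_add: "mat_vec d U (\<lambda>b. v b + w b) a = mat_vec d U v a + mat_vec d U w a"
  by (simp add: mat_vec_def distrib_left sum.distrib)

lemma mat_vec_diff: "mat_vec d U (\<lambda>b. v b - w b) a = mat_vec d U v a - mat_vec d U w a"
  by (simp add: mat_vec_def right_diff_distrib sum_subtractf)

text \<open>
  The Gaussian kernel at \<open>u + e\<close> and \<open>v\<close>: once the rotation is removed, the mean difference survives as a
  shift \<open>e\<close> of one argument.
\<close>
definition shift_kernel :: "real \<Rightarrow> nat \<Rightarrow> (nat \<Rightarrow> real) \<Rightarrow> (nat \<Rightarrow> real) \<Rightarrow> (nat \<Rightarrow> real) \<Rightarrow> real" where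
  "shift_kernel \<gamma> d e u v = exp (- (\<Sum>b<d. (u b - v b + e b)\<^sup>2) / \<gamma>\<^sup>2)"

definition latent_h where
  "latent_h \<gamma> d e s s' t t' =
     shift_kernel \<gamma> d (\<lambda>_. 0) s s' + shift_kernel \<gamma> d (\<lambda>_. 0) t t'
       - shift_kernel \<gamma> d e s t' - shift_kernel \<gamma> d e s' t"

text \<open>
  Both the noise and the mean difference are images under \<open>U\<close>, the latter because \<open>\<delta> = U (U\<^sup>T \<delta>)\<close>.
\<close>
lemma gauss_kernel_rotated:
  assumes U: "orthogonal_upto d U"
    and x: "\<And>a. a < d \<Longrightarrow> x a = mat_vec d U s a + \<mu> a"
    and y: "\<And>a. a < d \<Longrightarrow> y a = mat_vec d U t a + \<nu> a"
  shows "gauss_kernel \<gamma> d x y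
           = shift_kernel \<gamma> d (\<lambda>b. \<Sum>c<d. U c b * (\<mu> c - \<nu> c)) s t"
proof -
  let ?e = "\<lambda>b. \<Sum>c<d. U c b * (\<mu> c - \<nu> c)"
  have "(\<Sum>a<d. (x a - y a)\<^sup>2) = (\<Sum>a<d. (mat_vec d U (\<lambda>b. (s b - t b) + ?e b) a)\<^sup>2)"
    by (intro sum.cong refl arg_cong[where f = "\<lambda>z. z\<^sup>2"])
       (simp add: x y mat_vec_add mat_vec_diff orthogonal_mat_vec_transpose[OF U])
  also have "\<dots> = (\<Sum>b<d. (s b - t b + ?e b)\<^sup>2)"
    by (rule orthogonal_norm[OF U])
  finally show ?thesis
    by (simp add: gauss_kernel_eq shift_kernel_def)
qed

lemma mmd_h_rotated:
  assumes U: "orthogonal_upto d U"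
    and x: "\<And>a. a < d \<Longrightarrow> x a = mat_vec d U s a + \<mu> a" "\<And>a. a < d \<Longrightarrow> x' a = mat_vec d U s' a + \<mu> a"
    and y: "\<And>a. a < d \<Longrightarrow> y a = mat_vec d U t a + \<nu> a" "\<And>a. a < d \<Longrightarrow> y' a = mat_vec d U t' a + \<nu> a"
  shows "mmd_h (gauss_kernel \<gamma> d) (x, y) (x', y')
           = latent_h \<gamma> d (\<lambda>b. \<Sum>c<d. U c b * (\<mu> c - \<nu> c)) s s' t t'"
  unfolding mmd_h_def latent_h_def fst_conv snd_conv
  using gauss_kernel_rotated[OF U x(1) x(2)] gauss_kernel_rotated[OF U y(1) y(2)]
    gauss_kernel_rotated[OF U x(1) y(2)] gauss_kernel_rotated[OF U x(2) y(1)]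
  by simp

lemma shift_kernel_bounds: "0 < shift_kernel \<gamma> d e u v" "shift_kernel \<gamma> d e u v \<le> 1"
  by (auto simp: shift_kernel_def sum_nonneg)

section \<open>Studentised means of independent variables\<close>

text \<open>
  Condition on the value \<open>a\<close> of \<open>h j\<close>: the remaining variables are independent of it, and each of them hits \<open>a\<close>
  with probability at most \<open>q\<close>.
\<close>
lemma (in prob_space) prob_indep_all_equal:
  fixes h :: "'i \<Rightarrow> 'a \<Rightarrow> real"
  assumes I: "finite I" "j \<notin> I"
    and indep: "indep_vars (\<lambda>_. borel) h (insert j I)"
    and atom: "\<And>i a. i \<in> I \<Longrightarrow> prob {\<omega> \<in> space M. h i \<omega> = a} \<le> q"
  shows "prob {\<omega> \<in> space M. \<forall>i\<in>I. h i \<omega> = h j \<omega>} \<le> q ^ card I"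
proof -
  \<comment> \<open>The default outside the index set only serves to make every factor a probability measure.\<close>
  define D where "D i = (if i \<in> insert j I then distr M borel (h i) else return borel 0)" for i
  have rv [measurable]: "random_variable borel (h i)" if "i \<in> insert j I" for i
    using indep that by (auto simp: indep_vars_def)
  have D_prob: "prob_space (D i)" for i
    by (auto simp: D_def intro!: prob_space_distr prob_space_return rv)
  interpret D: product_prob_space D "insert j I"
    by (simp add: product_prob_space_def product_prob_space_axioms_def product_sigma_finite_def
        D_prob prob_space_imp_sigma_finite)
  have sets_D [measurable_cong, simp]: "sets (D i) = sets borel" for i
    by (simp add: D_def)
  have space_D [simp]: "space (D i) = UNIV" for i
    by (simp add: D_def)
  let ?J = "insert j I"
  have law: "distr M (Pi\<^sub>M ?J (\<lambda>_. borel)) (\<lambda>\<omega>. \<lambda>i\<in>?J. h i \<omega>) = Pi\<^sub>M ?J D"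
  proof -
    have "distr M (Pi\<^sub>M ?J (\<lambda>_. borel)) (\<lambda>\<omega>. \<lambda>i\<in>?J. h i \<omega>)
        = Pi\<^sub>M ?J (\<lambda>i. distr M borel (h i))"
      using indep by (subst (asm) indep_vars_iff_distr_eq_PiM') (auto intro: rv)
    also have "\<dots> = Pi\<^sub>M ?J D"
      by (intro PiM_cong) (auto simp: D_def)
    finally show ?thesis .
  qed
  define E where "E = {x \<in> space (Pi\<^sub>M ?J (\<lambda>_. borel)). \<forall>i\<in>I. x i = (x j :: real)}"
  have E_sets: "E \<in> sets (Pi\<^sub>M ?J (\<lambda>_. borel))"
    unfolding E_def using I
    by (intro sets.sets_Collect_finite_All borel_measurable_eq measurable_component_singleton) auto
  have E_sets' [measurable]: "E \<in> sets (Pi\<^sub>M ?J D)"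
    using E_sets by (simp cong: sets_PiM_cong)
  have q0: "0 \<le> q" if "i \<in> I" for i
    using atom[OF that, of 0] measure_nonneg order_trans by blast
  have atom_D: "emeasure (D i) {a} \<le> ennreal q" if "i \<in> I" for i a
  proof -
    have "emeasure (D i) {a} = emeasure M (h i -` {a} \<inter> space M)"
      using that rv by (simp add: D_def emeasure_distr)
    also have "\<dots> = ennreal (prob {\<omega> \<in> space M. h i \<omega> = a})"
      by (simp add: emeasure_eq_measure vimage_def Int_def conj_commute)
    also have "\<dots> \<le> ennreal q"
      by (intro ennreal_leI atom that)
    finally show ?thesis .
  qed
  have fibre: "(\<integral>\<^sup>+ x. indicator E (x(j := a)) \<partial>Pi\<^sub>M I D) \<le> ennreal q ^ card I" for a
  proof -
    have "(\<integral>\<^sup>+ x. indicator E (x(j := a)) \<partial>Pi\<^sub>M I D)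
        = (\<integral>\<^sup>+ x. indicator (Pi\<^sub>E I (\<lambda>_. {a})) x \<partial>Pi\<^sub>M I D)"
    proof (intro nn_integral_cong)
      fix x assume x: "x \<in> space (Pi\<^sub>M I D)"
      then have "x(j := a) \<in> E \<longleftrightarrow> (\<forall>i\<in>I. x i = a)"
        using I(2) by (auto simp: E_def space_PiM PiE_iff extensional_def)
      also have "\<dots> \<longleftrightarrow> x \<in> Pi\<^sub>E I (\<lambda>_. {a})"
        using x by (simp only: space_PiM PiE_iff singleton_iff) auto
      finally show "indicator E (x(j := a)) = (indicator (Pi\<^sub>E I (\<lambda>_. {a})) x :: ennreal)"
        by (simp only: indicator_def)
    qed
    also have "\<dots> = emeasure (Pi\<^sub>M I D) (Pi\<^sub>E I (\<lambda>_. {a}))"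
      using I by (intro nn_integral_indicator sets_PiM_I_finite) auto
    also have "\<dots> = (\<Prod>i\<in>I. emeasure (D i) {a})"
      using I by (intro D.emeasure_PiM) auto
    also have "\<dots> \<le> (\<Prod>i\<in>I. ennreal q)"
      by (intro prod_mono_ennreal atom_D)
    finally show ?thesis by simp
  qed
  have "emeasure (Pi\<^sub>M ?J D) E = (\<integral>\<^sup>+ x. indicator E x \<partial>Pi\<^sub>M ?J D)"
    by simp
  also have "\<dots> = (\<integral>\<^sup>+ a. \<integral>\<^sup>+ x. indicator E (x(j := a)) \<partial>Pi\<^sub>M I D \<partial>D j)"
    using I by (intro D.product_nn_integral_insert_rev) auto
  also have "\<dots> \<le> (\<integral>\<^sup>+ a. ennreal q ^ card I \<partial>D j)"
    by (intro nn_integral_mono fibre)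
  also have "\<dots> = ennreal q ^ card I"
    using prob_space.emeasure_space_1[OF D_prob, of j] by simp
  finally have le: "emeasure (Pi\<^sub>M ?J D) E \<le> ennreal q ^ card I" .
  have "emeasure (Pi\<^sub>M ?J D) E
      = emeasure M ((\<lambda>\<omega>. \<lambda>i\<in>?J. h i \<omega>) -` E \<inter> space M)"
    unfolding law[symmetric] by (intro emeasure_distr E_sets measurable_restrict rv)
  also have "(\<lambda>\<omega>. \<lambda>i\<in>?J. h i \<omega>) -` E \<inter> space M = {\<omega> \<in> space M. \<forall>i\<in>I. h i \<omega> = h j \<omega>}"
    by (auto simp: E_def space_PiM)
  finally have "ennreal (prob {\<omega> \<in> space M. \<forall>i\<in>I. h i \<omega> = h j \<omega>}) \<le> ennreal q ^ card I"
    using le by (simp add: emeasure_eq_measure)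
  also have "\<dots> = ennreal (q ^ card I)"
    using q0 by (cases "I = {}") (auto simp: ennreal_power)
  finally show ?thesis
    using q0 by (cases "I = {}") (auto simp: ennreal_le_iff)
qed

text \<open>
  Centred independent variables are orthogonal in \<open>L\<^sup>2\<close>. The lemma serves twice: for the average of the
  values of \<open>h\<close>, and for sums over the coordinates of a latent vector.
\<close>
lemma (in prob_space) expectation_square_indep_combination:
  fixes h :: "'i \<Rightarrow> 'a \<Rightarrow> real" and c :: "'i \<Rightarrow> real"
  assumes I: "finite I"
    and indep: "indep_vars (\<lambda>_. borel) h I"
    and int: "\<And>i. i \<in> I \<Longrightarrow> integrable M (\<lambda>\<omega>. (h i \<omega>)\<^sup>2)"
    and mean: "\<And>i. i \<in> I \<Longrightarrow> expectation (h i) = \<mu>"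
    and second: "\<And>i. i \<in> I \<Longrightarrow> expectation (\<lambda>\<omega>. (h i \<omega>)\<^sup>2) \<le> V"
  shows "integrable M (\<lambda>\<omega>. (\<Sum>i\<in>I. c i * (h i \<omega> - \<mu>))\<^sup>2)"
    and "expectation (\<lambda>\<omega>. (\<Sum>i\<in>I. c i * (h i \<omega> - \<mu>))\<^sup>2) \<le> V * (\<Sum>i\<in>I. (c i)\<^sup>2)"
proof -
  have rv [measurable]: "random_variable borel (h i)" if "i \<in> I" for i
    using indep that by (auto simp: indep_vars_def)
  have int1: "integrable M (h i)" if "i \<in> I" for i
    using square_integrable_imp_integrable[OF rv[OF that] int[OF that]] .
  have int1': "integrable M (\<lambda>\<omega>. h i \<omega> - \<mu>)" if "i \<in> I" for i
    using int1[OF that] by simp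
  define g where "g i j \<omega> = (h i \<omega> - \<mu>) * (h j \<omega> - \<mu>)" for i j \<omega>
  have diag: "integrable M (g i i)" "expectation (g i i) \<le> V" if "i \<in> I" for i
  proof -
    have *: "g i i = (\<lambda>\<omega>. (h i \<omega>)\<^sup>2 - 2 * \<mu> * h i \<omega> + \<mu>\<^sup>2)"
      by (auto simp: g_def power2_eq_square algebra_simps)
    show "integrable M (g i i)"
      unfolding * using int1[OF that] int[OF that] by simp
    have "expectation (g i i) = expectation (\<lambda>\<omega>. (h i \<omega>)\<^sup>2) - \<mu>\<^sup>2"
      unfolding * using int1[OF that] int[OF that] mean[OF that]
      by (simp add: prob_space power2_eq_square)
    then show "expectation (g i i) \<le> V"
      using second[OF that] zero_le_power2[of \<mu>] by linarith
  qed
  have cross: "integrable M (g i j)" "expectation (g i j) = 0"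
    if "i \<in> I" "j \<in> I" "i \<noteq> j" for i j
  proof -
    have ind: "indep_vars (\<lambda>_. borel) (\<lambda>k \<omega>. h k \<omega> - \<mu>) {i, j}"
      by (rule indep_vars_compose2[OF indep_vars_subset[OF indep]]) (use that in auto)
    have "integrable M (\<lambda>\<omega>. \<Prod>k\<in>{i, j}. h k \<omega> - \<mu>)"
      by (rule indep_vars_integrable[OF _ ind]) (use int1' that in auto)
    then show "integrable M (g i j)"
      using that by (simp add: g_def[abs_def])
    have "expectation (\<lambda>\<omega>. \<Prod>k\<in>{i, j}. h k \<omega> - \<mu>) = (\<Prod>k\<in>{i, j}. expectation (\<lambda>\<omega>. h k \<omega> - \<mu>))"
      by (rule indep_vars_lebesgue_integral[OF _ ind]) (use int1' that in auto)
    then have "expectation (g i j) = expectation (\<lambda>\<omega>. h i \<omega> - \<mu>) * expectation (\<lambda>\<omega>. h j \<omega> - \<mu>)"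
      using that by (simp add: g_def[abs_def])
    also have "\<dots> = 0"
      using int1[OF that(1)] mean[OF that(1)] by (simp add: prob_space)
    finally show "expectation (g i j) = 0" .
  qed
  have all_int: "integrable M (\<lambda>\<omega>. c i * c j * g i j \<omega>)" if "i \<in> I" "j \<in> I" for i j
    using diag(1) cross(1) that by (cases "i = j") auto
  have expand: "(\<lambda>\<omega>. (\<Sum>i\<in>I. c i * (h i \<omega> - \<mu>))\<^sup>2) = (\<lambda>\<omega>. \<Sum>i\<in>I. \<Sum>j\<in>I. c i * c j * g i j \<omega>)"
    by (simp add: power2_eq_square sum_product g_def ac_simps)
  show "integrable M (\<lambda>\<omega>. (\<Sum>i\<in>I. c i * (h i \<omega> - \<mu>))\<^sup>2)"
    unfolding expand by (intro Bochner_Integration.integrable_sum all_int)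
  have "expectation (\<lambda>\<omega>. (\<Sum>i\<in>I. c i * (h i \<omega> - \<mu>))\<^sup>2)
      = (\<Sum>i\<in>I. expectation (\<lambda>\<omega>. \<Sum>j\<in>I. c i * c j * g i j \<omega>))"
    unfolding expand by (intro Bochner_Integration.integral_sum Bochner_Integration.integrable_sum all_int)
  also have "\<dots> = (\<Sum>i\<in>I. \<Sum>j\<in>I. expectation (\<lambda>\<omega>. c i * c j * g i j \<omega>))"
    by (intro sum.cong refl Bochner_Integration.integral_sum all_int)
  also have "\<dots> = (\<Sum>i\<in>I. \<Sum>j\<in>I. if i = j then (c i)\<^sup>2 * expectation (g i i) else 0)"
    by (intro sum.cong refl) (auto simp: cross power2_eq_square)
  also have "\<dots> = (\<Sum>i\<in>I. (c i)\<^sup>2 * expectation (g i i))"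
    using I by simp
  also have "\<dots> \<le> (\<Sum>i\<in>I. (c i)\<^sup>2 * V)"
    by (intro sum_mono mult_left_mono diag) auto
  finally show "expectation (\<lambda>\<omega>. (\<Sum>i\<in>I. c i * (h i \<omega> - \<mu>))\<^sup>2) \<le> V * (\<Sum>i\<in>I. (c i)\<^sup>2)"
    by (simp add: sum_distrib_left mult.commute)
qed

text \<open>
  The deterministic part of the consistency argument: the average is at least half of \<open>\<mu>\<close>, and the empirical
  variance is nonzero and at most the empirical second moment, which \<open>sq\<close> keeps below a multiple of \<open>m \<mu>\<^sup>2 / z\<^sup>2\<close>.
\<close>
lemma studentized_ratio_gt:
  fixes h :: "nat \<Rightarrow> real" and z \<mu> :: real and m :: nat
  assumes m: "m \<ge> 1" and mu: "\<mu> > 0"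
    and ne: "\<not> (\<forall>i\<in>{2..m}. h i = h 1)"
    and dev: "(\<Sum>i=1..m. h i - \<mu>)\<^sup>2 < (real m * \<mu> / 2)\<^sup>2"
    and sq: "z\<^sup>2 * (\<Sum>i=1..m. (h i)\<^sup>2) < (real m * \<mu>)\<^sup>2 / 4"
  defines "a \<equiv> 1 / real m * (\<Sum>i=1..m. h i)"
  shows "z < sqrt (2 * real m) * a / sqrt (2 * (1 / real m * (\<Sum>i=1..m. (h i - a)\<^sup>2)))"
proof -
  let ?v = "\<Sum>i=1..m. (h i - a)\<^sup>2"
  have sum_a: "(\<Sum>i=1..m. h i) = real m * a"
    using m by (simp add: a_def)
  have "?v = (\<Sum>i=1..m. (h i)\<^sup>2 - 2 * a * h i + a\<^sup>2)"
    by (simp add: power2_eq_square algebra_simps)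
  also have "\<dots> = (\<Sum>i=1..m. (h i)\<^sup>2) - 2 * a * (\<Sum>i=1..m. h i) + real m * a\<^sup>2"
    by (simp add: sum.distrib sum_subtractf sum_distrib_left)
  also have "\<dots> = (\<Sum>i=1..m. (h i)\<^sup>2) - real m * a\<^sup>2"
    unfolding sum_a by (simp add: power2_eq_square)
  finally have v_le: "?v \<le> (\<Sum>i=1..m. (h i)\<^sup>2)"
    by simp
  have v_pos: "?v > 0"
  proof (rule ccontr)
    assume "\<not> ?v > 0"
    then have "?v = 0"
      by (smt (verit) sum_nonneg zero_le_power2)
    then have "\<forall>i\<in>{1..m}. (h i - a)\<^sup>2 = 0"
      by (subst (asm) sum_nonneg_eq_0_iff) auto
    then show False using ne m by auto
  qed
  have "\<bar>\<Sum>i=1..m. h i - \<mu>\<bar> < \<bar>real m * \<mu> / 2\<bar>"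
    using dev by (simp only: abs_le_square_iff not_le[symmetric] not_False_eq_True)
  moreover have "(\<Sum>i=1..m. h i - \<mu>) = real m * a - real m * \<mu>"
    unfolding sum_subtractf sum_a by simp
  moreover have "real m * \<mu> > 0"
    using m mu by simp
  ultimately have "real m * a > real m * \<mu> / 2"
    by (smt (verit) field_sum_of_halves)
  then have a_gt: "a > \<mu> / 2"
    using m by (simp add: field_simps)
  have "z\<^sup>2 * ?v \<le> z\<^sup>2 * (\<Sum>i=1..m. (h i)\<^sup>2)"
    by (intro mult_left_mono v_le) auto
  also have "\<dots> < (real m * \<mu>)\<^sup>2 / 4"
    by (rule sq)
  also have "\<dots> \<le> (real m * a)\<^sup>2"
  proof -
    have "(real m * (\<mu> / 2))\<^sup>2 \<le> (real m * a)\<^sup>2"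
      using a_gt mu by (intro power_mono mult_left_mono) auto
    then show ?thesis by (simp add: power_mult_distrib power_divide)
  qed
  finally have "z\<^sup>2 * ?v < (real m * a)\<^sup>2" .
  then have "sqrt (z\<^sup>2 * ?v) < sqrt ((real m * a)\<^sup>2)"
    by (rule real_sqrt_less_mono)
  then have "\<bar>z\<bar> * sqrt ?v < real m * a"
    using a_gt mu by (simp add: real_sqrt_mult)
  then have "\<bar>z\<bar> < real m * a / sqrt ?v"
    using v_pos by (simp add: field_simps)
  also have "real m * a / sqrt ?v = sqrt (2 * real m) * a / sqrt (2 * (1 / real m * ?v))"
  proof -
    define r V where "r = sqrt (real m)" and "V = sqrt ?v"
    have pos: "r > 0" "V > 0" and rr: "real m = r * r"
      using m v_pos by (auto simp: r_def V_def)
    have "sqrt (2 * (1 / real m * ?v)) = sqrt 2 * (V / r)"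
      unfolding V_def r_def by (simp add: real_sqrt_mult real_sqrt_divide)
    moreover have "sqrt (2 * real m) = sqrt 2 * r"
      unfolding r_def by (simp add: real_sqrt_mult)
    moreover have "r * r * a / V = sqrt 2 * r * a / (sqrt 2 * (V / r))"
      using pos by (simp add: field_simps)
    ultimately show ?thesis
      unfolding V_def[symmetric] by (simp only: rr)
  qed
  finally show ?thesis by linarith
qed

text \<open>
  The three error terms bound the probabilities that the variance estimate vanishes, that the average deviates
  from \<open>\<mu>\<close> by \<open>\<mu> / 2\<close> (Chebyshev), and that the empirical second moment is of order \<open>m \<mu>\<^sup>2\<close> (Markov). Only the
  ratio \<open>K\<close> of the second moment to the squared mean enters, so the bound is invariant under scaling of \<open>h\<close>.
\<close>
lemma (in prob_space) prob_studentized_ratio_gt: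
  fixes h :: "nat \<Rightarrow> 'a \<Rightarrow> real" and z \<mu> K q :: real and m :: nat
  assumes m: "m \<ge> 1" and mu: "\<mu> > 0"
    and indep: "indep_vars (\<lambda>_. borel) h {1..m}"
    and int: "\<And>i. i \<in> {1..m} \<Longrightarrow> integrable M (\<lambda>\<omega>. (h i \<omega>)\<^sup>2)"
    and mean: "\<And>i. i \<in> {1..m} \<Longrightarrow> expectation (h i) = \<mu>"
    and second: "\<And>i. i \<in> {1..m} \<Longrightarrow> expectation (\<lambda>\<omega>. (h i \<omega>)\<^sup>2) \<le> K * \<mu>\<^sup>2"
    and atom: "\<And>i a. i \<in> {1..m} \<Longrightarrow> prob {\<omega> \<in> space M. h i \<omega> = a} \<le> q"
  defines "a \<equiv> \<lambda>\<omega>. 1 / real m * (\<Sum>i=1..m. h i \<omega>)"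
  shows "prob {\<omega> \<in> space M.
           z < sqrt (2 * real m) * a \<omega> / sqrt (2 * (1 / real m * (\<Sum>i=1..m. (h i \<omega> - a \<omega>)\<^sup>2)))}
         \<ge> 1 - (q ^ (m - 1) + 4 * K / real m + 4 * K * z\<^sup>2 / real m)" (is "prob ?R \<ge> _")
proof -
  have rv [measurable]: "random_variable borel (h i)" if "i \<in> {1..m}" for i
    using indep that by (auto simp: indep_vars_def)
  define E1 where "E1 = {\<omega> \<in> space M. \<forall>i\<in>{2..m}. h i \<omega> = h 1 \<omega>}"
  define E2 where "E2 = {\<omega> \<in> space M. (real m * \<mu> / 2)\<^sup>2 \<le> (\<Sum>i=1..m. h i \<omega> - \<mu>)\<^sup>2}"
  define E3 where "E3 = {\<omega> \<in> space M. (real m * \<mu>)\<^sup>2 / 4 \<le> z\<^sup>2 * (\<Sum>i=1..m. (h i \<omega>)\<^sup>2)}"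
  have h1 [measurable]: "random_variable borel (h 1)"
    using m by (intro rv) auto
  have E1s [measurable]: "E1 \<in> sets M"
    unfolding E1_def by (intro sets.sets_Collect_finite_All borel_measurable_eq) auto
  have E2s [measurable]: "E2 \<in> sets M"
    unfolding E2_def by measurable
  have E3s [measurable]: "E3 \<in> sets M"
    unfolding E3_def by measurable
  have p1: "prob E1 \<le> q ^ (m - 1)"
  proof -
    have "insert 1 {2..m} = {1..m}" using m by auto
    then have "prob E1 \<le> q ^ card {2..m}"
      unfolding E1_def using indep atom
      by (intro prob_indep_all_equal) auto
    then show ?thesis by simp
  qed
  have mm: "real m > 0" using m by simp
  have p2: "prob E2 \<le> 4 * K / real m"
  proof -
    note S = expectation_square_indep_combination[OF _ indep int mean second, where c = "\<lambda>_. 1", simplified]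
    have "prob E2 \<le> expectation (\<lambda>\<omega>. (\<Sum>i=1..m. h i \<omega> - \<mu>)\<^sup>2) / (real m * \<mu> / 2)\<^sup>2"
      unfolding E2_def using S(1) mm mu by (intro integral_Markov_inequality_measure[where A = "{}"]) auto
    also have "\<dots> \<le> (real m * (K * \<mu>\<^sup>2)) / (real m * \<mu> / 2)\<^sup>2"
      using S(2) by (intro divide_right_mono) (auto simp: ac_simps)
    also have "\<dots> = 4 * K / real m"
      using mm mu by (simp add: field_simps power2_eq_square)
    finally show ?thesis .
  qed
  have p3: "prob E3 \<le> 4 * K * z\<^sup>2 / real m"
  proof -
    have "expectation (\<lambda>\<omega>. z\<^sup>2 * (\<Sum>i=1..m. (h i \<omega>)\<^sup>2)) = z\<^sup>2 * (\<Sum>i=1..m. expectation (\<lambda>\<omega>. (h i \<omega>)\<^sup>2))"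
      using int by simp
    also have "\<dots> \<le> z\<^sup>2 * (\<Sum>i=1..m. K * \<mu>\<^sup>2)"
      by (intro mult_left_mono sum_mono second) auto
    finally have *: "expectation (\<lambda>\<omega>. z\<^sup>2 * (\<Sum>i=1..m. (h i \<omega>)\<^sup>2)) \<le> z\<^sup>2 * (real m * (K * \<mu>\<^sup>2))"
      by simp
    have "prob E3 \<le> expectation (\<lambda>\<omega>. z\<^sup>2 * (\<Sum>i=1..m. (h i \<omega>)\<^sup>2)) / ((real m * \<mu>)\<^sup>2 / 4)"
      unfolding E3_def using int mm mu
      by (intro integral_Markov_inequality_measure[where A = "{}"]) (auto intro!: AE_I2 mult_nonneg_nonneg sum_nonneg)
    also have "\<dots> \<le> z\<^sup>2 * (real m * (K * \<mu>\<^sup>2)) / ((real m * \<mu>)\<^sup>2 / 4)"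
      using * by (intro divide_right_mono) auto
    also have "\<dots> = 4 * K * z\<^sup>2 / real m"
      using mm mu by (simp add: field_simps power2_eq_square)
    finally show ?thesis .
  qed
  have Rs: "?R \<in> sets M"
    unfolding a_def by measurable
  have cover: "space M - (E1 \<union> E2 \<union> E3) \<subseteq> ?R"
  proof
    fix \<omega> assume "\<omega> \<in> space M - (E1 \<union> E2 \<union> E3)"
    then show "\<omega> \<in> ?R"
      using studentized_ratio_gt[OF m mu, of "\<lambda>i. h i \<omega>" z]
      unfolding E1_def E2_def E3_def a_def by (simp only: mem_Collect_eq Diff_iff Un_iff not_le[symmetric]) blast
  qed
  have "prob (E1 \<union> E2 \<union> E3) \<le> prob E1 + prob E2 + prob E3"
    using measure_Un_le[of "E1 \<union> E2" M E3] measure_Un_le[of E1 M E2] by auto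
  moreover have "prob (space M - (E1 \<union> E2 \<union> E3)) = 1 - prob (E1 \<union> E2 \<union> E3)"
    by (intro prob_compl) auto
  moreover have "prob (space M - (E1 \<union> E2 \<union> E3)) \<le> prob ?R"
    by (intro finite_measure_mono cover Rs)
  ultimately show ?thesis
    using p1 p2 p3 by linarith
qed

section \<open>No value of \<open>h\<close> carries almost all the mass\<close>

lemma exists_small_value:
  fixes f :: "'a \<Rightarrow> ennreal"
  assumes "(\<integral>\<^sup>+ x. f x \<partial>N) < t * emeasure N A" "A \<in> sets N"
  shows "\<exists>x\<in>A. f x < t"
proof (rule ccontr)
  assume "\<not> ?thesis"
  then have "t * indicator A x \<le> f x" for x
    by (auto simp: indicator_def not_less)
  then have "(\<integral>\<^sup>+ x. t * indicator A x \<partial>N) \<le> (\<integral>\<^sup>+ x. f x \<partial>N)"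
    by (intro nn_integral_mono)
  then show False
    using assms by (simp add: nn_integral_cmult)
qed

lemma (in prob_space) exists_small_value_space:
  fixes f :: "'a \<Rightarrow> ennreal"
  assumes "(\<integral>\<^sup>+ x. f x \<partial>M) < t"
  shows "\<exists>x\<in>space M. f x < t"
  using exists_small_value[of M f t "space M"] assms by (simp add: emeasure_space_1)

text \<open>
  Two sets of positive mass such that points of the same set are closer to each other than points of different
  sets. Their masses depend on the coordinate law only, and so does the bound on the atoms of \<open>h\<close> that they yield.
\<close>
definition separated_sets :: "real measure \<Rightarrow> real \<Rightarrow> real set \<Rightarrow> real set \<Rightarrow> bool" where
  "separated_sets L r A B \<longleftrightarrow>
     A \<in> sets L \<and> B \<in> sets L \<and> measure L A > 0 \<and> measure L B > 0 \<and>
     (\<forall>u\<in>A. \<forall>p\<in>A. \<bar>u - p\<bar> \<le> r) \<and> (\<forall>u\<in>B. \<forall>p\<in>B. \<bar>u - p\<bar> \<le> r) \<and> (\<forall>u\<in>A. \<forall>p\<in>B. r < \<bar>u - p\<bar>)"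

lemma exists_small_piece:
  fixes M :: "real measure"
  assumes M: "prob_space M"
    and sets: "sets M = sets borel" and S: "S \<in> sets borel" "measure M S > 0" and r: "r > 0"
  shows "\<exists>A\<in>sets borel. A \<subseteq> S \<and> measure M A > 0 \<and> (\<forall>u\<in>A. \<forall>p\<in>A. \<bar>u - p\<bar> \<le> r)"
proof -
  interpret prob_space M by fact
  define P where "P j = {x \<in> S. \<lfloor>x / r\<rfloor> = j}" for j :: int
  have P_sets: "P j \<in> sets borel" for j
  proof -
    have "P j = S \<inter> {x. \<lfloor>x / r\<rfloor> = j}" by (auto simp: P_def)
    also have "\<dots> \<in> sets borel" using S(1) by measurable
    finally show ?thesis .
  qed
  have "\<exists>j. prob (P j) > 0"
  proof (rule ccontr)
    assume "\<not> ?thesis"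
    then have "P j \<in> null_sets M" for j
      using P_sets[of j] sets measure_nonneg[of M "P j"]
      by (auto simp: null_sets_def emeasure_eq_measure not_less order.antisym)
    then have "(\<Union>j\<in>UNIV. P j) \<in> null_sets M"
      by (intro null_sets_UN') auto
    moreover have "(\<Union>j\<in>UNIV. P j) = S"
      by (auto simp: P_def)
    ultimately show False
      using S(2) by (auto simp: null_sets_def measure_def)
  qed
  then obtain j where j: "prob (P j) > 0" ..
  have "\<bar>u - p\<bar> \<le> r" if "u \<in> P j" "p \<in> P j" for u p
  proof -
    have "\<lfloor>u / r\<rfloor> = j" "\<lfloor>p / r\<rfloor> = j"
      using that by (auto simp: P_def)
    then have "\<bar>u / r - p / r\<bar> \<le> 1" by linarith
    then have "\<bar>u - p\<bar> / r \<le> 1"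
      using r by (simp add: diff_divide_distrib[symmetric] abs_divide)
    then show ?thesis using r by simp
  qed
  then show ?thesis
    using j P_sets[of j] by (intro bexI[of _ "P j"]) (auto simp: P_def)
qed

text \<open>
  A nondegenerate law with mean \<open>0\<close> charges both \<open>(-\<infinity>, 0]\<close> and some \<open>[\<eta>, \<infinity>)\<close>; each of these is covered by
  countably many intervals of length \<open>\<eta> / 2\<close>, one of which must have positive mass.
\<close>
lemma separated_sets_exist:
  fixes M :: "real measure"
  assumes M: "prob_space M" and sets: "sets M = sets borel" and int: "integrable M (\<lambda>x. x)"
    and mean: "prob_space.expectation M (\<lambda>x. x) = 0" and var: "prob_space.variance M (\<lambda>x. x) > 0"
  shows "\<exists>r A B. separated_sets M r A B"
proof -
  interpret prob_space M by fact
  note [measurable_cong] = sets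
  have space: "space M = UNIV"
    using sets_eq_imp_space_eq[OF sets] by simp
  have nonzero: "\<not> (AE x in M. x = 0)"
  proof
    assume "AE x in M. x = 0"
    then have "variance (\<lambda>x. x) = (\<integral>x. 0 \<partial>M)"
      unfolding mean by (intro integral_cong_AE) auto
    then show False using var by simp
  qed
  have pos: "prob {0<..} > 0"
  proof (rule ccontr)
    assume "\<not> ?thesis"
    then have "AE x in M. \<not> x > 0"
      using prob_Collect_eq_0[of "\<lambda>x. x > 0"] measure_nonneg[of M "{0<..}"]
      by (simp add: space greaterThan_def not_less order.antisym)
    then have "AE x in M. 0 \<le> - x" by (auto simp: not_less)
    moreover have "(\<integral>x. - x \<partial>M) = 0" using mean by simp
    ultimately have "AE x in M. - x = 0"
      using integral_nonneg_eq_0_iff_AE[of M "\<lambda>x. - x"] int by simp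
    then show False using nonzero by simp
  qed
  have neg: "prob {..0} > 0"
  proof (rule ccontr)
    assume "\<not> ?thesis"
    then have AE: "AE x in M. \<not> x \<le> 0"
      using prob_Collect_eq_0[of "\<lambda>x. x \<le> 0"] measure_nonneg[of M "{..0}"]
      by (simp add: space atMost_def not_less order.antisym)
    then have "AE x in M. 0 \<le> x" by auto
    then have "AE x in M. x = 0"
      using integral_nonneg_eq_0_iff_AE[of M "\<lambda>x. x"] int mean by simp
    then show False using nonzero by simp
  qed
  have "\<exists>j::nat. prob {1 / real (Suc j)..} > 0"
  proof (rule ccontr)
    assume "\<not> ?thesis"
    then have "{1 / real (Suc j)..} \<in> null_sets M" for j
      using measure_nonneg[of M "{1 / real (Suc j)..}"] sets
      by (auto simp: null_sets_def emeasure_eq_measure not_less order.antisym)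
    then have "(\<Union>j. {1 / real (Suc j)..}) \<in> null_sets M"
      by (rule null_sets_UN)
    moreover have "(\<Union>j. {1 / real (Suc j)..}) = {0::real<..}"
    proof (intro equalityI subsetI)
      fix x :: real assume "x \<in> {0<..}"
      then obtain j where "inverse (real (Suc j)) < x"
        using reals_Archimedean by auto
      then show "x \<in> (\<Union>j. {1 / real (Suc j)..})"
        by (auto simp: inverse_eq_divide intro!: exI[of _ j])
    next
      fix x :: real assume "x \<in> (\<Union>j. {1 / real (Suc j)..})"
      then obtain j where "1 / real (Suc j) \<le> x" by auto
      moreover have "0 < 1 / real (Suc j)" by simp
      ultimately have "0 < x" by (rule order.strict_trans2[rotated])
      then show "x \<in> {0<..}" by simp
    qed
    ultimately show False
      using pos by (auto simp: null_sets_def measure_def)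
  qed
  then obtain j :: nat where j: "prob {1 / real (Suc j)..} > 0" ..
  define \<eta> where "\<eta> = 1 / real (Suc j)"
  have eta: "\<eta> > 0" by (simp add: \<eta>_def)
  obtain A where A: "A \<in> sets borel" "A \<subseteq> {..0}" "prob A > 0" "\<forall>u\<in>A. \<forall>p\<in>A. \<bar>u - p\<bar> \<le> \<eta> / 2"
    using exists_small_piece[OF M sets _ neg, of "\<eta> / 2"] eta by auto
  obtain B where B: "B \<in> sets borel" "B \<subseteq> {\<eta>..}" "prob B > 0" "\<forall>u\<in>B. \<forall>p\<in>B. \<bar>u - p\<bar> \<le> \<eta> / 2"
    using exists_small_piece[OF M sets _ j, of "\<eta> / 2"] eta unfolding \<eta>_def[symmetric] by auto
  have "\<eta> / 2 < \<bar>u - p\<bar>" if "u \<in> A" "p \<in> B" for u p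
  proof -
    have "u \<le> 0" "\<eta> \<le> p" using that A(2) B(2) by auto
    then show ?thesis using eta by linarith
  qed
  then have "separated_sets M (\<eta> / 2) A B"
    using A B sets by (auto simp: separated_sets_def)
  then show ?thesis by blast
qed

lemma shift_kernel_measurable [measurable (raw)]:
  assumes L: "sets L = sets borel"
    and f: "f \<in> N \<rightarrow>\<^sub>M Pi\<^sub>M {..<d} (\<lambda>_. L)" and g: "g \<in> N \<rightarrow>\<^sub>M Pi\<^sub>M {..<d} (\<lambda>_. L)"
  shows "(\<lambda>x. shift_kernel \<gamma> d e (f x) (g x)) \<in> borel_measurable N"
proof -
  have *: "(\<lambda>x. f x b) \<in> borel_measurable N" "(\<lambda>x. g x b) \<in> borel_measurable N" if "b < d" for b
    using measurable_compose[OF f measurable_component_singleton[of b]]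
      measurable_compose[OF g measurable_component_singleton[of b]] that
    by (auto simp: measurable_cong_sets[OF refl L])
  show ?thesis
    unfolding shift_kernel_def using *
    by (intro borel_measurable_exp[THEN measurable_compose[rotated]] borel_measurable_divide
        borel_measurable_uminus borel_measurable_sum borel_measurable_power borel_measurable_add
        borel_measurable_diff borel_measurable_const) auto
qed

lemma latent_h_measurable [measurable (raw)]:
  assumes L: "sets L = sets borel"
    and f: "f \<in> N \<rightarrow>\<^sub>M Pi\<^sub>M {..<d} (\<lambda>_. L)" "f' \<in> N \<rightarrow>\<^sub>M Pi\<^sub>M {..<d} (\<lambda>_. L)"
      "g \<in> N \<rightarrow>\<^sub>M Pi\<^sub>M {..<d} (\<lambda>_. L)" "g' \<in> N \<rightarrow>\<^sub>M Pi\<^sub>M {..<d} (\<lambda>_. L)"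
  shows "(\<lambda>x. latent_h \<gamma> d e (f x) (f' x) (g x) (g' x)) \<in> borel_measurable N"
  unfolding latent_h_def
  by (intro borel_measurable_add borel_measurable_diff shift_kernel_measurable[OF L] f)

lemma shift_kernel_first_coordinate_less:
  assumes "\<gamma> > 0" "d \<ge> 1" "\<bar>u - p\<bar> < \<bar>u' - p'\<bar>"
  shows "shift_kernel \<gamma> d (\<lambda>_. 0) (x(0 := u')) (x'(0 := p'))
       < shift_kernel \<gamma> d (\<lambda>_. 0) (x(0 := u)) (x'(0 := p))"
proof -
  have split: "{..<d} = insert 0 {1..<d}" using assms(2) by auto
  have eq: "(\<Sum>b<d. ((x(0 := u)) b - (x'(0 := p)) b + 0)\<^sup>2) = (u - p)\<^sup>2 + (\<Sum>b\<in>{1..<d}. (x b - x' b)\<^sup>2)" for u p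
    unfolding split by (subst sum.insert) auto
  have "(u - p)\<^sup>2 < (u' - p')\<^sup>2"
    using assms(3) abs_le_square_iff[of "u' - p'" "u - p"] by linarith
  then show ?thesis
    unfolding shift_kernel_def eq using assms(1) by (simp add: divide_strict_right_mono)
qed

text \<open>
  If the probability of \<open>h \<noteq> a\<close> were smaller, Fubini's theorem would give vectors \<open>x\<close>, \<open>x'\<close>, together with
  \<open>u, p \<in> A\<close> and \<open>u', p' \<in> B\<close> for the first coordinates of \<open>s\<close> and \<open>s'\<close>, such that all four combinations lead to the
  value \<open>a\<close>. In the mixed difference of these four values the terms that depend on \<open>s\<close> alone or on \<open>s'\<close> alone
  cancel, and what remains is positive because \<open>A\<close> and \<open>B\<close> are separated.
\<close>
lemma latent_h_not_concentrated:
  assumes L: "prob_space L" "sets L = sets borel" and sep: "separated_sets L r A B"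
    and d: "d \<ge> 1" and g: "\<gamma> > 0"
  defines "\<rho> \<equiv> min (measure L A) (measure L B)"
  defines "V \<equiv> Pi\<^sub>M {..<d} (\<lambda>_. L)"
  assumes tV: "t \<in> space V" "t' \<in> space V"
  shows "ennreal (\<rho>\<^sup>2 / 4) \<le> (\<integral>\<^sup>+ s. \<integral>\<^sup>+ s'. indicator (- {a}) (latent_h \<gamma> d e s s' t t') \<partial>V \<partial>V)"
proof (rule ccontr)
  assume contra: "\<not> ?thesis"
  interpret L: prob_space L by fact
  interpret product_prob_space "\<lambda>_::nat. L" "{..<d}"
    by (simp add: product_prob_space_def product_prob_space_axioms_def product_sigma_finite_def
        L.prob_space_axioms L.sigma_finite_measure_axioms)
  let ?W = "Pi\<^sub>M {1..<d} (\<lambda>_. L)"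
  have W: "prob_space ?W" by (intro prob_space_PiM L.prob_space_axioms)
  have V: "prob_space V" unfolding V_def by (intro prob_space_PiM L.prob_space_axioms)
  interpret V: prob_space V by fact
  have split: "{..<d} = insert 0 {1..<d}" using d by auto
  have insert: "(\<integral>\<^sup>+ s. f s \<partial>V) = (\<integral>\<^sup>+ x. \<integral>\<^sup>+ u. f (x(0 := u)) \<partial>L \<partial>?W)"
    if "f \<in> borel_measurable V" for f
    unfolding V_def split using that unfolding V_def split
    by (intro product_nn_integral_insert) auto
  have rho: "0 < \<rho>" and AB: "A \<in> sets L" "B \<in> sets L"
    using sep by (auto simp: \<rho>_def separated_sets_def)
  have le: "ennreal c < ennreal t * emeasure L A" "ennreal c < ennreal t * emeasure L B"
    if "c < t * \<rho>" "0 < t" "0 \<le> c" for c t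
  proof -
    have "t * \<rho> \<le> t * measure L A" "t * \<rho> \<le> t * measure L B"
      using that by (auto simp: \<rho>_def intro!: mult_left_mono)
    then have "c < t * measure L A" "c < t * measure L B"
      using that by linarith+
    then show "ennreal c < ennreal t * emeasure L A" "ennreal c < ennreal t * emeasure L B"
      using that by (auto simp: L.emeasure_eq_measure ennreal_mult[symmetric] ennreal_less_iff)
  qed
  define \<phi> where "\<phi> s s' = (indicator (- {a}) (latent_h \<gamma> d e s s' t t') :: ennreal)" for s s'
  have pair_meas: "case_prod \<phi> \<in> borel_measurable (V \<Otimes>\<^sub>M V)"
  proof -
    have "(\<lambda>z. latent_h \<gamma> d e (fst z) (snd z) t t') \<in> borel_measurable (V \<Otimes>\<^sub>M V)"
      using tV unfolding V_def by (intro latent_h_measurable[OF L(2)]) auto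
    then show ?thesis
      unfolding \<phi>_def case_prod_beta by measurable
  qed
  have F_meas: "(\<lambda>s. \<integral>\<^sup>+ s'. \<phi> s s' \<partial>V) \<in> borel_measurable V"
    using V.borel_measurable_nn_integral[OF pair_meas] .
  have \<phi>_meas: "\<phi> s \<in> borel_measurable V" if "s \<in> space V" for s
    using measurable_compose[OF measurable_Pair1'[OF that] pair_meas] by simp
  have upd: "x(0 := u) \<in> space V" if "x \<in> space ?W" for x u
  proof -
    have "space L = UNIV" using sets_eq_imp_space_eq[OF L(2)] by simp
    then show ?thesis using that unfolding V_def split by (auto simp: space_PiM PiE_iff extensional_def)
  qed
  have "(\<integral>\<^sup>+ x. \<integral>\<^sup>+ u. \<integral>\<^sup>+ s'. \<phi> (x(0 := u)) s' \<partial>V \<partial>L \<partial>?W) < ennreal (\<rho>\<^sup>2 / 4)"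
    using contra insert[OF F_meas] by (simp add: \<phi>_def)
  then obtain x where x: "x \<in> space ?W"
    and xi: "(\<integral>\<^sup>+ u. \<integral>\<^sup>+ s'. \<phi> (x(0 := u)) s' \<partial>V \<partial>L) < ennreal (\<rho>\<^sup>2 / 4)"
    using prob_space.exists_small_value_space[OF W] by blast
  \<comment> \<open>Strictness at each step leaves room: the sum \<open>2 \<rho> / 3\<close> of both bounds stays below \<open>3 \<rho> / 4 < \<rho>\<close>.\<close>
  have quarter: "\<rho>\<^sup>2 / 4 < (\<rho> / 3) * \<rho>"
    using rho by (simp add: power2_eq_square)
  obtain u where u: "u \<in> A" "(\<integral>\<^sup>+ s'. \<phi> (x(0 := u)) s' \<partial>V) < ennreal (\<rho> / 3)"
    using exists_small_value[OF order.strict_trans[OF xi le(1)[OF quarter]] AB(1)] rho by auto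
  obtain u' where u': "u' \<in> B" "(\<integral>\<^sup>+ s'. \<phi> (x(0 := u')) s' \<partial>V) < ennreal (\<rho> / 3)"
    using exists_small_value[OF order.strict_trans[OF xi le(2)[OF quarter]] AB(2)] rho by auto
  let ?G = "\<lambda>s'. \<phi> (x(0 := u)) s' + \<phi> (x(0 := u')) s'"
  have G_meas: "?G \<in> borel_measurable V"
    by (intro borel_measurable_add \<phi>_meas upd x)
  have "(\<integral>\<^sup>+ s'. ?G s' \<partial>V) = (\<integral>\<^sup>+ s'. \<phi> (x(0 := u)) s' \<partial>V) + (\<integral>\<^sup>+ s'. \<phi> (x(0 := u')) s' \<partial>V)"
    by (intro nn_integral_add \<phi>_meas upd x)
  also have "\<dots> \<le> ennreal (\<rho> / 3) + ennreal (\<rho> / 3)"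
    using u u' by (intro add_mono) auto
  also have "\<dots> = ennreal (2 * \<rho> / 3)"
    using rho by (simp add: ennreal_plus[symmetric] del: ennreal_plus)
  also have "\<dots> < ennreal (3 * \<rho> / 4)"
    using rho by (simp add: ennreal_less_iff)
  finally obtain x' where x': "x' \<in> space ?W" and x'i: "(\<integral>\<^sup>+ p. ?G (x'(0 := p)) \<partial>L) < ennreal (3 * \<rho> / 4)"
    unfolding insert[OF G_meas] using prob_space.exists_small_value_space[OF W] by blast
  have quarter': "3 * \<rho> / 4 < 1 * \<rho>" using rho by simp
  obtain p where p: "p \<in> A" "?G (x'(0 := p)) < 1"
    using exists_small_value[OF order.strict_trans[OF x'i le(1)[OF quarter']] AB(1)] rho by auto
  obtain p' where p': "p' \<in> B" "?G (x'(0 := p')) < 1"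
    using exists_small_value[OF order.strict_trans[OF x'i le(2)[OF quarter']] AB(2)] rho by auto
  \<comment> \<open>A sum of two indicators that is below \<open>1\<close> vanishes, so \<open>p\<close> suits both \<open>u\<close> and \<open>u'\<close>, and so does \<open>p'\<close>.\<close>
  have zero: "v = 0 \<and> w = 0" if "v + w < 1" "v \<in> {0, 1}" "w \<in> {0, 1}" for v w :: ennreal
    using that by auto
  have 01: "\<phi> s s' \<in> {0, 1}" for s s' by (auto simp: \<phi>_def indicator_def)
  have value_eq: "latent_h \<gamma> d e s s' t t' = a" if "\<phi> s s' = 0" for s s'
    using that by (auto simp: \<phi>_def indicator_def split: if_splits)
  have "latent_h \<gamma> d e (x(0 := u)) (x'(0 := p)) t t' = a" "latent_h \<gamma> d e (x(0 := u')) (x'(0 := p)) t t' = a"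
       "latent_h \<gamma> d e (x(0 := u)) (x'(0 := p')) t t' = a" "latent_h \<gamma> d e (x(0 := u')) (x'(0 := p')) t t' = a"
    using zero[OF p(2) 01 01] zero[OF p'(2) 01 01] by (auto intro: value_eq)
  then have "shift_kernel \<gamma> d (\<lambda>_. 0) (x(0 := u)) (x'(0 := p)) + shift_kernel \<gamma> d (\<lambda>_. 0) (x(0 := u')) (x'(0 := p'))
           = shift_kernel \<gamma> d (\<lambda>_. 0) (x(0 := u)) (x'(0 := p')) + shift_kernel \<gamma> d (\<lambda>_. 0) (x(0 := u')) (x'(0 := p))"
    by (simp add: latent_h_def)
  moreover have "\<bar>u - p\<bar> \<le> r" "\<bar>u' - p'\<bar> \<le> r" "r < \<bar>u - p'\<bar>" "r < \<bar>p - u'\<bar>"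
    using sep u(1) u'(1) p(1) p'(1) unfolding separated_sets_def by blast+
  then have "\<bar>u - p\<bar> < \<bar>u - p'\<bar>" "\<bar>u' - p'\<bar> < \<bar>u' - p\<bar>"
    by linarith+
  then have "shift_kernel \<gamma> d (\<lambda>_. 0) (x(0 := u)) (x'(0 := p')) < shift_kernel \<gamma> d (\<lambda>_. 0) (x(0 := u)) (x'(0 := p))"
       "shift_kernel \<gamma> d (\<lambda>_. 0) (x(0 := u')) (x'(0 := p)) < shift_kernel \<gamma> d (\<lambda>_. 0) (x(0 := u')) (x'(0 := p'))"
    using shift_kernel_first_coordinate_less[OF g d] by blast+
  ultimately show False by linarith
qed

section \<open>Elementary bounds on the Gaussian kernel\<close>

lemma exp_neg_diff_abs_le:
  fixes a b :: real
  assumes "0 \<le> a" "0 \<le> b"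
  shows "\<bar>exp (- a) - exp (- b)\<bar> \<le> \<bar>a - b\<bar>" "\<bar>exp (- a) - exp (- b)\<bar> \<le> 1"
proof -
  have *: "exp (- a) - exp (- b) \<le> b - a" if "0 \<le> a" "a \<le> b" for a b :: real
  proof -
    have "exp (- a) * (1 - exp (- (b - a))) \<le> 1 * (b - a)"
    proof (intro mult_mono)
      show "1 - exp (- (b - a)) \<le> b - a"
        using exp_ge_add_one_self[of "- (b - a)"] by linarith
    qed (use that in auto)
    then show ?thesis by (simp add: algebra_simps exp_add[symmetric])
  qed
  show "\<bar>exp (- a) - exp (- b)\<bar> \<le> \<bar>a - b\<bar>"
    using *[of a b] *[of b a] assms by (cases "a \<le> b") auto
  have "exp (- a) \<le> 1" "exp (- b) \<le> 1" "0 < exp (- a)" "0 < exp (- b)"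
    using assms by auto
  then show "\<bar>exp (- a) - exp (- b)\<bar> \<le> 1" by linarith
qed

lemma one_minus_exp_half_ge:
  fixes z :: real
  assumes "0 \<le> z"
  shows "min 1 z / 4 \<le> 1 - exp (- (z / 2))"
proof -
  define y where "y = min 1 z"
  have y: "0 \<le> y" "y \<le> 1" "y \<le> z" using assms by (auto simp: y_def)
  have "exp (- (z / 2)) \<le> exp (- (y / 2))" using y by simp
  also have "\<dots> \<le> 1 / (1 + y / 2)"
    using exp_ge_add_one_self[of "y / 2"] y by (simp add: exp_minus inverse_eq_divide frac_le)
  also have "\<dots> \<le> 1 - y / 4"
  proof -
    have "1 \<le> (1 - y / 4) * (1 + y / 2)"
      using y mult_left_mono[of y 1 y] by (simp add: algebra_simps)
    then show ?thesis using y by (simp add: divide_le_eq)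
  qed
  finally show ?thesis by (simp add: y_def)
qed

text \<open>
  For \<open>\<bar>X\<bar> \<le> N / 4\<close> the exponent grows by at least \<open>N / (2 g)\<close>, which gains a factor of order \<open>min 1 (N / g)\<close>.
  Otherwise \<open>1 \<le> 16 X\<^sup>2 / N\<^sup>2\<close>, and the difference is bounded both by \<open>1\<close> and by \<open>6 \<bar>X\<bar> / g\<close>, hence by
  \<open>24 min 1 (N / g) X\<^sup>2 / N\<^sup>2\<close>. The constant \<open>28 = 24 + 4\<close> also pays for the leading term, which is
  at most \<open>1 / 4\<close>. A single inequality that is linear in \<open>X\<^sup>2\<close> can be integrated without splitting into events.
\<close>
lemma kernel_gap_pointwise:
  fixes R X N g :: real
  assumes g: "g > 0" and N: "N > 0" and R: "R \<ge> 0" and C: "R + 2 * X + N \<ge> 0"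
  shows "min 1 (N / g) * (exp (- (R / g)) / 4 - 28 * X\<^sup>2 / N\<^sup>2)
       \<le> exp (- (R / g)) - exp (- ((R + 2 * X + N) / g))"
proof (cases "\<bar>X\<bar> \<le> N / 4")
  case True
  let ?w = "min 1 (N / g)"
  have "N / 2 \<le> 2 * X + N" using True by linarith
  then have "N / g / 2 \<le> (2 * X + N) / g"
    using g by (simp add: field_simps)
  then have "exp (- ((2 * X + N) / g)) \<le> exp (- (N / g / 2))" by simp
  then have "?w / 4 \<le> 1 - exp (- ((2 * X + N) / g))"
    using one_minus_exp_half_ge[of "N / g"] divide_nonneg_nonneg[of N g] N g by linarith
  then have "exp (- (R / g)) * (?w / 4) \<le> exp (- (R / g)) * (1 - exp (- ((2 * X + N) / g)))"
    by (intro mult_left_mono) auto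
  also have "\<dots> = exp (- (R / g)) - exp (- ((R + 2 * X + N) / g))"
    by (simp add: algebra_simps exp_add[symmetric] add_divide_distrib)
  finally have "?w * (exp (- (R / g)) / 4) \<le> exp (- (R / g)) - exp (- ((R + 2 * X + N) / g))"
    by (simp add: mult.commute)
  moreover have "?w * (exp (- (R / g)) / 4 - 28 * X\<^sup>2 / N\<^sup>2) \<le> ?w * (exp (- (R / g)) / 4)"
    using N g by (intro mult_left_mono) auto
  ultimately show ?thesis by linarith
next
  case False
  let ?w = "min 1 (N / g)" and ?q = "X\<^sup>2 / N\<^sup>2"
  have X: "N < 4 * \<bar>X\<bar>" using False by linarith
  have w: "0 < ?w" using N g by simp
  have q1: "1 \<le> 16 * ?q"
  proof -
    have "N\<^sup>2 \<le> (4 * \<bar>X\<bar>)\<^sup>2" using X N by (intro power_mono) auto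
    then show ?thesis using N by (simp add: power_mult_distrib field_simps)
  qed
  have "\<bar>exp (- (R / g)) - exp (- ((R + 2 * X + N) / g))\<bar> \<le> ?w * (24 * ?q)"
  proof (cases "N / g \<le> 1")
    case True
    have "\<bar>exp (- (R / g)) - exp (- ((R + 2 * X + N) / g))\<bar> \<le> \<bar>R / g - (R + 2 * X + N) / g\<bar>"
      using g R C by (intro exp_neg_diff_abs_le) auto
    also have "\<dots> = \<bar>2 * X + N\<bar> / g"
      using g by (simp add: diff_divide_distrib[symmetric])
    also have "\<dots> \<le> 6 * \<bar>X\<bar> / g"
      using X N g by (intro divide_right_mono) auto
    also have "\<dots> \<le> (N / g) * (24 * ?q)"
    proof -
      have "\<bar>X\<bar> * N \<le> \<bar>X\<bar> * (4 * \<bar>X\<bar>)" using X by (intro mult_left_mono) auto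
      moreover have "\<bar>X\<bar> * \<bar>X\<bar> = X\<^sup>2" by (simp add: power2_eq_square)
      ultimately have "6 * \<bar>X\<bar> * N \<le> 24 * X\<^sup>2" by linarith
      then show ?thesis using N g by (simp add: field_simps power2_eq_square)
    qed
    finally show ?thesis using True by simp
  next
    case False
    have "\<bar>exp (- (R / g)) - exp (- ((R + 2 * X + N) / g))\<bar> \<le> 1"
      using g R C by (intro exp_neg_diff_abs_le) auto
    then show ?thesis using False q1 by simp
  qed
  moreover have "?w * (exp (- (R / g)) / 4 - 28 * X\<^sup>2 / N\<^sup>2) \<le> ?w * (- (24 * ?q))"
  proof -
    have "exp (- (R / g)) \<le> 1" using R g by simp
    moreover have "28 * X\<^sup>2 / N\<^sup>2 = 28 * ?q" by simp
    ultimately have "exp (- (R / g)) / 4 - 28 * X\<^sup>2 / N\<^sup>2 \<le> - (24 * ?q)"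
      using q1 by linarith
    then show ?thesis using w by (intro mult_left_mono) auto
  qed
  ultimately show ?thesis by linarith
qed

text \<open>
  Integrates the pointwise bound, with \<open>exp (- r)\<close> replaced by its tangent at \<open>\<Gamma>\<close> so that only the mean of \<open>R\<close>
  is needed.
\<close>
lemma (in prob_space) kernel_gap_mean:
  fixes R X :: "'a \<Rightarrow> real" and N g \<Gamma> \<kappa> :: real
  assumes g: "g > 0" and N: "N > 0"
    and R: "\<And>\<omega>. R \<omega> \<ge> 0" and C: "\<And>\<omega>. R \<omega> + 2 * X \<omega> + N \<ge> 0"
    and intR: "integrable M R" and ER: "expectation R \<le> \<Gamma> * g"
    and [measurable]: "X \<in> borel_measurable M"
    and intX: "integrable M (\<lambda>\<omega>. (X \<omega>)\<^sup>2)" and EX: "expectation (\<lambda>\<omega>. (X \<omega>)\<^sup>2) \<le> \<kappa> * N"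
  shows "min 1 (N / g) * (exp (- \<Gamma>) / 4 - 28 * \<kappa> / N)
       \<le> expectation (\<lambda>\<omega>. exp (- (R \<omega> / g)) - exp (- ((R \<omega> + 2 * X \<omega> + N) / g)))"
proof -
  let ?w = "min 1 (N / g)"
  have [measurable]: "R \<in> borel_measurable M" using intR by auto
  have tangent: "exp (- \<Gamma>) * (1 + \<Gamma> - r) \<le> exp (- r)" for r :: real
  proof -
    have "exp (- \<Gamma>) * (1 + (\<Gamma> - r)) \<le> exp (- \<Gamma>) * exp (\<Gamma> - r)"
      by (intro mult_left_mono exp_ge_add_one_self) auto
    then show ?thesis by (simp add: exp_add[symmetric] algebra_simps)
  qed
  have w: "0 \<le> ?w" using N g by simp
  define F where "F \<omega> = ?w * (exp (- \<Gamma>) * (1 + \<Gamma> - R \<omega> / g) / 4 - 28 / N\<^sup>2 * (X \<omega>)\<^sup>2)" for \<omega>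
  have F_le: "F \<omega> \<le> exp (- (R \<omega> / g)) - exp (- ((R \<omega> + 2 * X \<omega> + N) / g))" for \<omega>
  proof -
    have "F \<omega> \<le> ?w * (exp (- (R \<omega> / g)) / 4 - 28 * (X \<omega>)\<^sup>2 / N\<^sup>2)"
      unfolding F_def using tangent[of "R \<omega> / g"] w by (intro mult_left_mono) auto
    also have "\<dots> \<le> exp (- (R \<omega> / g)) - exp (- ((R \<omega> + 2 * X \<omega> + N) / g))"
      by (rule kernel_gap_pointwise[OF g N R C])
    finally show ?thesis .
  qed
  have F_int: "integrable M F"
    unfolding F_def[abs_def] using intR intX by simp
  have "?w * (exp (- \<Gamma>) / 4 - 28 * \<kappa> / N)
      \<le> ?w * (exp (- \<Gamma>) * (1 + \<Gamma> - expectation R / g) / 4 - 28 / N\<^sup>2 * expectation (\<lambda>\<omega>. (X \<omega>)\<^sup>2))"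
  proof (intro mult_left_mono w diff_mono)
    have "expectation R / g \<le> \<Gamma>" using ER g by (simp add: divide_le_eq)
    then have "exp (- \<Gamma>) * 1 \<le> exp (- \<Gamma>) * (1 + \<Gamma> - expectation R / g)"
      by (intro mult_left_mono) auto
    then show "exp (- \<Gamma>) / 4 \<le> exp (- \<Gamma>) * (1 + \<Gamma> - expectation R / g) / 4" by simp
    have "28 / N\<^sup>2 * expectation (\<lambda>\<omega>. (X \<omega>)\<^sup>2) \<le> 28 / N\<^sup>2 * (\<kappa> * N)"
      by (intro mult_left_mono EX) auto
    then show "28 / N\<^sup>2 * expectation (\<lambda>\<omega>. (X \<omega>)\<^sup>2) \<le> 28 * \<kappa> / N"
      using N by (simp add: power2_eq_square field_simps)
  qed
  also have "\<dots> = expectation F"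
    unfolding F_def[abs_def] using intR intX by (simp add: prob_space)
  also have "\<dots> \<le> expectation (\<lambda>\<omega>. exp (- (R \<omega> / g)) - exp (- ((R \<omega> + 2 * X \<omega> + N) / g)))"
  proof (intro integral_mono F_int F_le)
    show "integrable M (\<lambda>\<omega>. exp (- (R \<omega> / g)) - exp (- ((R \<omega> + 2 * X \<omega> + N) / g)))"
    proof (rule integrable_const_bound[where B = 1])
      show "AE \<omega> in M. norm (exp (- (R \<omega> / g)) - exp (- ((R \<omega> + 2 * X \<omega> + N) / g))) \<le> 1"
        using exp_neg_diff_abs_le(2)[of "R _ / g" "(R _ + 2 * X _ + N) / g"] R C g by auto
    qed simp
  qed
  finally show ?thesis .
qed

text \<open>
  \<open>exp\<close> is \<open>1\<close>-Lipschitz and bounded by \<open>1\<close> on the negative half-line; the two bounds together give the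
  factor \<open>min 1 (N / g)\<close>.
\<close>
lemma (in prob_space) kernel_fluctuation:
  fixes Y :: "'a \<Rightarrow> real" and g \<rho> \<tau> N :: real
  assumes g: "g > 0" and Y: "\<And>\<omega>. Y \<omega> \<ge> 0" and rho: "\<rho> \<ge> 0" and tau: "\<tau> \<ge> 1" and N: "N > 0"
    and [measurable]: "Y \<in> borel_measurable M"
    and int: "integrable M (\<lambda>\<omega>. (Y \<omega> - \<rho>)\<^sup>2)"
    and E: "expectation (\<lambda>\<omega>. (Y \<omega> - \<rho>)\<^sup>2) \<le> \<tau> * N\<^sup>2"
  shows "expectation (\<lambda>\<omega>. (exp (- (Y \<omega> / g)) - exp (- (\<rho> / g)))\<^sup>2) \<le> \<tau> * (min 1 (N / g))\<^sup>2"
proof -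
  let ?f = "\<lambda>\<omega>. (exp (- (Y \<omega> / g)) - exp (- (\<rho> / g)))\<^sup>2"
  have le1: "?f \<omega> \<le> 1" for \<omega>
    using exp_neg_diff_abs_le(2)[of "Y \<omega> / g" "\<rho> / g"] Y[of \<omega>] rho g by (simp add: abs_square_le_1)
  have le2: "?f \<omega> \<le> (Y \<omega> - \<rho>)\<^sup>2 / g\<^sup>2" for \<omega>
  proof -
    have "\<bar>exp (- (Y \<omega> / g)) - exp (- (\<rho> / g))\<bar> \<le> \<bar>Y \<omega> / g - \<rho> / g\<bar>"
      using Y[of \<omega>] rho g by (intro exp_neg_diff_abs_le) auto
    then have "?f \<omega> \<le> (Y \<omega> / g - \<rho> / g)\<^sup>2" by (simp add: abs_le_square_iff)
    then show ?thesis by (simp add: diff_divide_distrib[symmetric] power_divide)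
  qed
  have intf: "integrable M ?f"
    by (rule integrable_const_bound[where B = 1]) (use le1 in auto)
  have "expectation ?f \<le> expectation (\<lambda>\<omega>. (Y \<omega> - \<rho>)\<^sup>2 / g\<^sup>2)"
    using int by (intro integral_mono intf le2) auto
  also have "\<dots> \<le> \<tau> * (N / g)\<^sup>2"
    using E g by (simp add: power_divide divide_right_mono)
  finally have A: "expectation ?f \<le> \<tau> * (N / g)\<^sup>2" .
  have "expectation ?f \<le> expectation (\<lambda>_. 1)"
    by (intro integral_mono intf le1) auto
  then have B: "expectation ?f \<le> 1" by (simp add: prob_space)
  show ?thesis
    using A B tau by (cases "N / g \<le> 1") (auto simp: min_def)
qed

section \<open>Moments of the difference of two latent vectors\<close>

text \<open>
  The coordinate law with the moments that the proof uses. \<open>V\<close> is the law of a latent vector and \<open>Q\<close> that of an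
  independent pair of them.
\<close>
locale centred_law =
  fixes L :: "real measure" and \<sigma> m4 :: real and d :: nat
  assumes L: "prob_space L" "sets L = sets borel"
    and mean: "integrable L (\<lambda>x. x)" "(\<integral>x. x \<partial>L) = 0"
    and second: "integrable L (\<lambda>x. x\<^sup>2)" "(\<integral>x. x\<^sup>2 \<partial>L) = \<sigma>\<^sup>2"
    and fourth: "integrable L (\<lambda>x. x ^ 4)" "(\<integral>x. x ^ 4 \<partial>L) = m4"
begin

abbreviation V :: "(nat \<Rightarrow> real) measure" where
  "V \<equiv> Pi\<^sub>M {..<d} (\<lambda>_. L)"

lemma prob_space_V: "prob_space V"
  by (intro prob_space_PiM L)

lemma coordinate_distr:
  assumes "b < d"
  shows "distr V borel (\<lambda>u. u b) = L"
proof -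
  have "distr V L (\<lambda>u. u b) = L"
    using assms L by (intro distr_PiM_component) auto
  moreover have "distr V L (\<lambda>u. u b) = distr V borel (\<lambda>u. u b)"
    by (intro distr_cong L) auto
  ultimately show ?thesis by simp
qed

lemma coordinate_measurable: "b < d \<Longrightarrow> (\<lambda>u. u b) \<in> borel_measurable V"
  using measurable_component_singleton[of b "{..<d}" "\<lambda>_. L"] measurable_cong_sets[OF refl L(2)] by blast

lemma coordinate_moment:
  assumes "b < d"
  shows "(\<integral>u. (u b) ^ r \<partial>V) = (\<integral>x. x ^ r \<partial>L)"
    and "integrable L (\<lambda>x. x ^ r) \<Longrightarrow> integrable V (\<lambda>u. (u b) ^ r)"
proof -
  have m: "(\<lambda>x::real. x ^ r) \<in> borel_measurable borel" by simp
  note c = coordinate_measurable[OF assms]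
  show "(\<integral>u. (u b) ^ r \<partial>V) = (\<integral>x. x ^ r \<partial>L)"
    using integral_distr[OF c m] unfolding coordinate_distr[OF assms] by simp
  show "integrable L (\<lambda>x. x ^ r) \<Longrightarrow> integrable V (\<lambda>u. (u b) ^ r)"
    using integrable_distr_eq[OF c m] unfolding coordinate_distr[OF assms] by simp
qed

lemma coordinates_indep: "prob_space.indep_vars V (\<lambda>_. borel) (\<lambda>b u. u b) {..<d}"
proof -
  interpret V: prob_space V by (rule prob_space_V)
  show ?thesis
  proof (cases "d = 0")
    case True
    then show ?thesis unfolding V.indep_vars_def V.indep_sets_def by auto
  next
    case False
    have "distr V (Pi\<^sub>M {..<d} (\<lambda>_. borel)) (\<lambda>u. \<lambda>b\<in>{..<d}. u b) = distr V V (\<lambda>u. u)"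
    proof (intro distr_cong refl sets_PiM_cong)
      fix u assume "u \<in> space V"
      then show "(\<lambda>b\<in>{..<d}. u b) = u"
        by (auto simp: space_PiM PiE_iff extensional_restrict)
    qed (use L in auto)
    also have "\<dots> = V" by (rule distr_id)
    also have "V = Pi\<^sub>M {..<d} (\<lambda>b. distr V borel (\<lambda>u. u b))"
      by (intro PiM_cong refl) (simp add: coordinate_distr)
    finally show ?thesis
      using False by (subst V.indep_vars_iff_distr_eq_PiM') (auto intro: coordinate_measurable)
  qed
qed

lemma V_linear:
  fixes e :: "nat \<Rightarrow> real"
  shows "integrable V (\<lambda>u. (\<Sum>b<d. e b * u b)\<^sup>2)"
    and "(\<integral>u. (\<Sum>b<d. e b * u b)\<^sup>2 \<partial>V) \<le> \<sigma>\<^sup>2 * (\<Sum>b<d. (e b)\<^sup>2)"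
proof -
  interpret V: prob_space V by (rule prob_space_V)
  have *: "integrable V (\<lambda>u. (u b)\<^sup>2)" "V.expectation (\<lambda>u. u b) = 0" "V.expectation (\<lambda>u. (u b)\<^sup>2) \<le> \<sigma>\<^sup>2"
    if "b \<in> {..<d}" for b
    using that coordinate_moment[of b 2] coordinate_moment(1)[of b 1] mean second by simp_all
  note C = V.expectation_square_indep_combination[OF _ coordinates_indep *, where c = e]
  show "integrable V (\<lambda>u. (\<Sum>b<d. e b * u b)\<^sup>2)"
    "(\<integral>u. (\<Sum>b<d. e b * u b)\<^sup>2 \<partial>V) \<le> \<sigma>\<^sup>2 * (\<Sum>b<d. (e b)\<^sup>2)"
    using C by simp_all
qed

lemma V_norm:
  shows "integrable V (\<lambda>u. \<Sum>b<d. (u b)\<^sup>2)"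
    and "(\<integral>u. (\<Sum>b<d. (u b)\<^sup>2) \<partial>V) = real d * \<sigma>\<^sup>2"
    and "integrable V (\<lambda>u. ((\<Sum>b<d. (u b)\<^sup>2) - real d * \<sigma>\<^sup>2)\<^sup>2)"
    and "(\<integral>u. ((\<Sum>b<d. (u b)\<^sup>2) - real d * \<sigma>\<^sup>2)\<^sup>2 \<partial>V) \<le> real d * m4"
proof -
  interpret V: prob_space V by (rule prob_space_V)
  have sq: "integrable V (\<lambda>u. (u b)\<^sup>2)" "(\<integral>u. (u b)\<^sup>2 \<partial>V) = \<sigma>\<^sup>2" if "b \<in> {..<d}" for b
    using that coordinate_moment[of b 2] second by simp_all
  show "integrable V (\<lambda>u. \<Sum>b<d. (u b)\<^sup>2)"
    by (intro Bochner_Integration.integrable_sum sq)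
  show "(\<integral>u. (\<Sum>b<d. (u b)\<^sup>2) \<partial>V) = real d * \<sigma>\<^sup>2"
    using sq by (simp add: Bochner_Integration.integral_sum)
  have ind: "V.indep_vars (\<lambda>_. borel) (\<lambda>b u. (u b)\<^sup>2) {..<d}"
    by (rule V.indep_vars_compose2[OF coordinates_indep]) auto
  have 4: "integrable V (\<lambda>u. ((u b)\<^sup>2)\<^sup>2)" "(\<integral>u. ((u b)\<^sup>2)\<^sup>2 \<partial>V) \<le> m4" if "b \<in> {..<d}" for b
    using that coordinate_moment[of b 4] fourth by (simp_all flip: power_mult)
  note C = V.expectation_square_indep_combination[OF _ ind 4(1) sq(2) 4(2), where c = "\<lambda>_. 1"]
  have eq: "(\<Sum>b<d. 1 * ((u b)\<^sup>2 - \<sigma>\<^sup>2)) = (\<Sum>b<d. (u b)\<^sup>2) - real d * \<sigma>\<^sup>2" for u :: "nat \<Rightarrow> real"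
    by (simp add: sum_subtractf)
  show "integrable V (\<lambda>u. ((\<Sum>b<d. (u b)\<^sup>2) - real d * \<sigma>\<^sup>2)\<^sup>2)"
    "(\<integral>u. ((\<Sum>b<d. (u b)\<^sup>2) - real d * \<sigma>\<^sup>2)\<^sup>2 \<partial>V) \<le> real d * m4"
    using C unfolding eq by (simp_all add: mult.commute)
qed

abbreviation Q where "Q \<equiv> V \<Otimes>\<^sub>M V"

lemma prob_space_Q: "prob_space Q"
  by (intro prob_space_pair prob_space_V)

lemma Q_fst:
  fixes f :: "(nat \<Rightarrow> real) \<Rightarrow> real"
  assumes "integrable V f"
  shows "integrable Q (\<lambda>z. f (fst z))" "(\<integral>z. f (fst z) \<partial>Q) = (\<integral>u. f u \<partial>V)"
proof -
  interpret V: prob_space V by (rule prob_space_V)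
  have D: "distr Q V fst = V" by (rule V.distr_pair_fst)
  have f: "f \<in> borel_measurable V" using assms by auto
  show "integrable Q (\<lambda>z. f (fst z))"
    using assms integrable_distr_eq[OF measurable_fst[of V V] f] by (simp add: D)
  show "(\<integral>z. f (fst z) \<partial>Q) = (\<integral>u. f u \<partial>V)"
    using integral_distr[OF measurable_fst[of V V] f] by (simp add: D)
qed

lemma Q_snd:
  fixes f :: "(nat \<Rightarrow> real) \<Rightarrow> real"
  assumes "integrable V f"
  shows "integrable Q (\<lambda>z. f (snd z))" "(\<integral>z. f (snd z) \<partial>Q) = (\<integral>u. f u \<partial>V)"
proof -
  interpret V: prob_space V by (rule prob_space_V)
  interpret pair_sigma_finite V V by unfold_locales
  interpret Q: prob_space Q by (rule prob_space_Q)
  have f: "f \<in> borel_measurable V" using assms by auto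
  have D: "distr Q V snd = V"
  proof (rule measure_eqI)
    fix A assume A: "A \<in> sets (distr Q V snd)"
    then have "emeasure (distr Q V snd) A = emeasure Q (space V \<times> A)"
      by (subst emeasure_distr) (auto simp: space_pair_measure dest: sets.sets_into_space intro!: arg_cong[where f = "emeasure Q"])
    also have "\<dots> = emeasure V A"
      using A by (simp add: V.emeasure_pair_measure_Times V.emeasure_space_1)
    finally show "emeasure (distr Q V snd) A = emeasure V A" .
  qed simp
  show "integrable Q (\<lambda>z. f (snd z))"
    using assms integrable_distr_eq[OF measurable_snd[of V V] f] by (simp add: D)
  show "(\<integral>z. f (snd z) \<partial>Q) = (\<integral>u. f u \<partial>V)"
    using integral_distr[OF measurable_snd[of V V] f] by (simp add: D)
qed

lemma Q_coordinate_measurable [measurable]: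
  "b < d \<Longrightarrow> (\<lambda>z. fst z b) \<in> borel_measurable Q" "b < d \<Longrightarrow> (\<lambda>z. snd z b) \<in> borel_measurable Q"
  using measurable_compose[OF measurable_fst coordinate_measurable]
    measurable_compose[OF measurable_snd coordinate_measurable] by auto

text \<open>
  For fixed \<open>u\<close> the inner product with \<open>u\<close> is a linear combination of the coordinates of the other vector.
\<close>
lemma Q_inner_square:
  shows "integrable Q (\<lambda>z. (\<Sum>b<d. fst z b * snd z b)\<^sup>2)"
    and "(\<integral>z. (\<Sum>b<d. fst z b * snd z b)\<^sup>2 \<partial>Q) \<le> real d * \<sigma> ^ 4"
proof -
  interpret V: prob_space V by (rule prob_space_V)
  let ?f = "\<lambda>z. (\<Sum>b<d. fst z b * snd z b)\<^sup>2"
  have [measurable]: "?f \<in> borel_measurable Q"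
    by (intro borel_measurable_power borel_measurable_sum borel_measurable_times Q_coordinate_measurable) auto
  have "(\<integral>\<^sup>+ z. ennreal (?f z) \<partial>Q) = (\<integral>\<^sup>+ u. \<integral>\<^sup>+ v. ennreal ((\<Sum>b<d. u b * v b)\<^sup>2) \<partial>V \<partial>V)"
    by (subst V.nn_integral_fst[symmetric]) auto
  also have "\<dots> \<le> (\<integral>\<^sup>+ u. ennreal (\<sigma>\<^sup>2 * (\<Sum>b<d. (u b)\<^sup>2)) \<partial>V)"
  proof (intro nn_integral_mono)
    fix u
    show "(\<integral>\<^sup>+ v. ennreal ((\<Sum>b<d. u b * v b)\<^sup>2) \<partial>V) \<le> ennreal (\<sigma>\<^sup>2 * (\<Sum>b<d. (u b)\<^sup>2))"
      using V_linear[of u] by (subst nn_integral_eq_integral) (auto intro: ennreal_leI)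
  qed
  also have "\<dots> = ennreal (\<integral>u. \<sigma>\<^sup>2 * (\<Sum>b<d. (u b)\<^sup>2) \<partial>V)"
    using V_norm(1) by (intro nn_integral_eq_integral) (auto simp: sum_nonneg)
  also have "(\<integral>u. \<sigma>\<^sup>2 * (\<Sum>b<d. (u b)\<^sup>2) \<partial>V) = real d * \<sigma> ^ 4"
    using V_norm(2) by (simp add: power2_eq_square power4_eq_xxxx)
  finally have le: "(\<integral>\<^sup>+ z. ennreal (?f z) \<partial>Q) \<le> ennreal (real d * \<sigma> ^ 4)" .
  show int: "integrable Q ?f"
    using le by (intro integrableI_nonneg) (auto intro: le_less_trans)
  show "(\<integral>z. ?f z \<partial>Q) \<le> real d * \<sigma> ^ 4"
    using le int by (subst (asm) nn_integral_eq_integral) auto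
qed

lemma Q_linear:
  fixes e :: "nat \<Rightarrow> real"
  defines "X \<equiv> \<lambda>z. \<Sum>b<d. e b * (fst z b - snd z b)"
  shows "X \<in> borel_measurable Q" and "integrable Q (\<lambda>z. (X z)\<^sup>2)"
    and "(\<integral>z. (X z)\<^sup>2 \<partial>Q) \<le> 4 * \<sigma>\<^sup>2 * (\<Sum>b<d. (e b)\<^sup>2)"
proof -
  show [measurable]: "X \<in> borel_measurable Q"
    unfolding X_def by (intro borel_measurable_sum borel_measurable_times borel_measurable_diff
        Q_coordinate_measurable borel_measurable_const) auto
  let ?A = "\<lambda>u. (\<Sum>b<d. e b * u b)\<^sup>2"
  have le: "(X z)\<^sup>2 \<le> 2 * ?A (fst z) + 2 * ?A (snd z)" for z
  proof -
    have "X z = (\<Sum>b<d. e b * fst z b) - (\<Sum>b<d. e b * snd z b)"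
      by (simp add: X_def right_diff_distrib sum_subtractf)
    moreover have "(a - b)\<^sup>2 \<le> 2 * a\<^sup>2 + 2 * b\<^sup>2" for a b :: real
      using zero_le_power2[of "a + b"] by (simp add: power2_eq_square algebra_simps)
    ultimately show ?thesis by (simp only:)
  qed
  note i = Q_fst[OF V_linear(1)[of e]] Q_snd[OF V_linear(1)[of e]]
  have int: "integrable Q (\<lambda>z. 2 * ?A (fst z) + 2 * ?A (snd z))"
    using i by simp
  show iX: "integrable Q (\<lambda>z. (X z)\<^sup>2)"
    by (rule Bochner_Integration.integrable_bound[OF int]) (use le in \<open>auto intro: order.trans\<close>)
  have "(\<integral>z. (X z)\<^sup>2 \<partial>Q) \<le> (\<integral>z. 2 * ?A (fst z) + 2 * ?A (snd z) \<partial>Q)"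
    by (intro integral_mono iX int le)
  also have "\<dots> \<le> 4 * \<sigma>\<^sup>2 * (\<Sum>b<d. (e b)\<^sup>2)"
    using i V_linear(2)[of e] by simp
  finally show "(\<integral>z. (X z)\<^sup>2 \<partial>Q) \<le> 4 * \<sigma>\<^sup>2 * (\<Sum>b<d. (e b)\<^sup>2)" .
qed

text \<open>
  \<open>\<parallel>u - u'\<parallel>\<^sup>2 - 2 \<sigma>\<^sup>2 d\<close> splits into the fluctuations of \<open>\<parallel>u\<parallel>\<^sup>2\<close> and \<open>\<parallel>u'\<parallel>\<^sup>2\<close>, controlled by the fourth moment, and
  the inner product \<open>- 2 \<langle>u, u'\<rangle>\<close>.
\<close>
lemma Q_norm:
  defines "R \<equiv> \<lambda>z. \<Sum>b<d. (fst z b - snd z b)\<^sup>2"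
  shows "integrable Q R" and "(\<integral>z. R z \<partial>Q) \<le> 4 * \<sigma>\<^sup>2 * real d"
    and "integrable Q (\<lambda>z. (R z - 2 * \<sigma>\<^sup>2 * real d)\<^sup>2)"
    and "(\<integral>z. (R z - 2 * \<sigma>\<^sup>2 * real d)\<^sup>2 \<partial>Q) \<le> (6 * m4 + 12 * \<sigma> ^ 4) * real d"
proof -
  have [measurable]: "R \<in> borel_measurable Q"
    unfolding R_def by (intro borel_measurable_sum borel_measurable_power borel_measurable_diff
        Q_coordinate_measurable) auto
  let ?S = "\<lambda>u::nat \<Rightarrow> real. \<Sum>b<d. (u b)\<^sup>2"
  let ?I = "\<lambda>z. \<Sum>b<d. fst z b * snd z b :: real"
  have R_eq: "R z = ?S (fst z) + ?S (snd z) - 2 * ?I z" for z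
    by (simp add: R_def power2_diff sum.distrib sum_subtractf sum_distrib_left mult.assoc)
  have R_le: "R z \<le> 2 * ?S (fst z) + 2 * ?S (snd z)" for z
  proof -
    have "R z \<le> (\<Sum>b<d. 2 * (fst z b)\<^sup>2 + 2 * (snd z b)\<^sup>2)"
      unfolding R_def
    proof (intro sum_mono)
      fix b show "(fst z b - snd z b)\<^sup>2 \<le> 2 * (fst z b)\<^sup>2 + 2 * (snd z b)\<^sup>2"
        using zero_le_power2[of "fst z b + snd z b"] by (simp add: power2_eq_square algebra_simps)
    qed
    then show ?thesis by (simp add: sum.distrib sum_distrib_left)
  qed
  have R_nonneg: "0 \<le> R z" for z by (simp add: R_def sum_nonneg)
  note i = Q_fst[OF V_norm(1)] Q_snd[OF V_norm(1)]
  have int: "integrable Q (\<lambda>z. 2 * ?S (fst z) + 2 * ?S (snd z))"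
    using i by simp
  show iR: "integrable Q R"
    by (rule Bochner_Integration.integrable_bound[OF int])
       (simp, intro AE_I2, use R_le R_nonneg in \<open>simp only: real_norm_def abs_of_nonneg\<close>,
        rule order.trans[OF R_le abs_ge_self])
  have "(\<integral>z. R z \<partial>Q) \<le> (\<integral>z. 2 * ?S (fst z) + 2 * ?S (snd z) \<partial>Q)"
    by (intro integral_mono iR int R_le)
  also have "\<dots> = 4 * \<sigma>\<^sup>2 * real d"
    using i V_norm(2) by simp
  finally show "(\<integral>z. R z \<partial>Q) \<le> 4 * \<sigma>\<^sup>2 * real d" .
  let ?D = "\<lambda>u. (?S u - real d * \<sigma>\<^sup>2)\<^sup>2"
  have le: "(R z - 2 * \<sigma>\<^sup>2 * real d)\<^sup>2 \<le> 3 * ?D (fst z) + 3 * ?D (snd z) + 12 * (?I z)\<^sup>2" for z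
  proof -
    have three: "(a + b - 2 * c)\<^sup>2 \<le> 3 * a\<^sup>2 + 3 * b\<^sup>2 + 12 * c\<^sup>2" for a b c :: real
      using zero_le_power2[of "a - b"] zero_le_power2[of "a + 2 * c"] zero_le_power2[of "b + 2 * c"]
      by (simp add: power2_eq_square algebra_simps)
    have "R z - 2 * \<sigma>\<^sup>2 * real d = (?S (fst z) - real d * \<sigma>\<^sup>2) + (?S (snd z) - real d * \<sigma>\<^sup>2) - 2 * ?I z"
      by (simp add: R_eq)
    then show ?thesis by (simp only: three)
  qed
  note j = Q_fst[OF V_norm(3)] Q_snd[OF V_norm(3)] Q_inner_square
  have int2: "integrable Q (\<lambda>z. 3 * ?D (fst z) + 3 * ?D (snd z) + 12 * (?I z)\<^sup>2)"
    using j by simp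
  show iD: "integrable Q (\<lambda>z. (R z - 2 * \<sigma>\<^sup>2 * real d)\<^sup>2)"
    by (rule Bochner_Integration.integrable_bound[OF int2]) (use le in \<open>auto intro: order.trans\<close>)
  have "(\<integral>z. (R z - 2 * \<sigma>\<^sup>2 * real d)\<^sup>2 \<partial>Q) \<le> (\<integral>z. 3 * ?D (fst z) + 3 * ?D (snd z) + 12 * (?I z)\<^sup>2 \<partial>Q)"
    by (intro integral_mono iD int2 le)
  also have "\<dots> = 3 * (\<integral>u. ?D u \<partial>V) + 3 * (\<integral>u. ?D u \<partial>V) + 12 * (\<integral>z. (?I z)\<^sup>2 \<partial>Q)"
    using j by simp
  also have "\<dots> \<le> (6 * m4 + 12 * \<sigma> ^ 4) * real d"
    using V_norm(4) j(6) by (simp add: algebra_simps)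
  finally show "(\<integral>z. (R z - 2 * \<sigma>\<^sup>2 * real d)\<^sup>2 \<partial>Q) \<le> (6 * m4 + 12 * \<sigma> ^ 4) * real d" .
qed

end

section \<open>Kernel moments over a pair of latent vectors\<close>

lemma shifted_square_sum:
  fixes u v e :: "nat \<Rightarrow> real"
  shows "(\<Sum>b<d. (u b - v b + e b)\<^sup>2)
       = (\<Sum>b<d. (u b - v b)\<^sup>2) + 2 * (\<Sum>b<d. e b * (u b - v b)) + (\<Sum>b<d. (e b)\<^sup>2)"
proof -
  have "(\<Sum>b<d. (u b - v b + e b)\<^sup>2)
      = (\<Sum>b<d. (u b - v b)\<^sup>2 + 2 * (e b * (u b - v b)) + (e b)\<^sup>2)"
    by (intro sum.cong refl) (simp add: power2_eq_square algebra_simps)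
  then show ?thesis
    by (simp add: sum.distrib sum_distrib_left)
qed

lemma shift_kernel_expand:
  "shift_kernel \<gamma> d e u v =
     exp (- (((\<Sum>b<d. (u b - v b)\<^sup>2) + 2 * (\<Sum>b<d. e b * (u b - v b)) + (\<Sum>b<d. (e b)\<^sup>2)) / \<gamma>\<^sup>2))"
  unfolding shift_kernel_def shifted_square_sum by (simp only: minus_divide_left)

context centred_law
begin

lemma fourth_moment_nonneg: "0 \<le> m4"
  unfolding fourth(2)[symmetric] by (intro integral_nonneg_AE) auto

lemma Q_kernel_measurable: "(\<lambda>z. shift_kernel \<gamma> d e (fst z) (snd z)) \<in> borel_measurable Q"
  by (rule shift_kernel_measurable[OF L(2)]) auto

lemma Q_kernel_integrable: "integrable Q (\<lambda>z. shift_kernel \<gamma> d e (fst z) (snd z))"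
proof -
  interpret Q: prob_space Q by (rule prob_space_Q)
  show ?thesis
    by (rule Q.integrable_const_bound[where B = 1])
       (use shift_kernel_bounds[of \<gamma> d e] in \<open>auto simp: abs_of_pos intro: Q_kernel_measurable\<close>)
qed

text \<open>
  The lower bound on \<open>N\<close> makes the error \<open>112 \<sigma>\<^sup>2 / N\<close> of \<open>kernel_gap_mean\<close> at most half of its main term.
\<close>
lemma Q_kernel_gap:
  fixes e :: "nat \<Rightarrow> real"
  defines "N \<equiv> \<Sum>b<d. (e b)\<^sup>2"
  assumes g: "\<gamma> > 0" and N: "N > 0" and Gam: "4 * \<sigma>\<^sup>2 * real d \<le> \<Gamma> * \<gamma>\<^sup>2"
    and large: "896 * \<sigma>\<^sup>2 * exp \<Gamma> \<le> N"
  shows "min 1 (N / \<gamma>\<^sup>2) * (exp (- \<Gamma>) / 8)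
       \<le> (\<integral>z. shift_kernel \<gamma> d (\<lambda>_. 0) (fst z) (snd z) \<partial>Q) - (\<integral>z. shift_kernel \<gamma> d e (fst z) (snd z) \<partial>Q)"
proof -
  interpret Q: prob_space Q by (rule prob_space_Q)
  let ?R = "\<lambda>z::(nat \<Rightarrow> real) \<times> (nat \<Rightarrow> real). \<Sum>b<d. (fst z b - snd z b)\<^sup>2"
  let ?X = "\<lambda>z::(nat \<Rightarrow> real) \<times> (nat \<Rightarrow> real). \<Sum>b<d. e b * (fst z b - snd z b)"
  have C: "0 \<le> ?R z + 2 * ?X z + N" for z
  proof -
    have "?R z + 2 * ?X z + N = (\<Sum>b<d. (fst z b - snd z b + e b)\<^sup>2)"
      unfolding shifted_square_sum N_def ..
    then show ?thesis by (simp add: sum_nonneg)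
  qed
  have "exp (- \<Gamma>) / 8 \<le> exp (- \<Gamma>) / 4 - 28 * (4 * \<sigma>\<^sup>2) / N"
  proof -
    have "exp (- \<Gamma>) * (896 * \<sigma>\<^sup>2 * exp \<Gamma>) \<le> exp (- \<Gamma>) * N"
      by (intro mult_left_mono large) auto
    then have "896 * \<sigma>\<^sup>2 \<le> exp (- \<Gamma>) * N"
      by (simp add: exp_minus field_simps)
    then show ?thesis using N by (simp add: field_simps)
  qed
  then have "min 1 (N / \<gamma>\<^sup>2) * (exp (- \<Gamma>) / 8)
      \<le> min 1 (N / \<gamma>\<^sup>2) * (exp (- \<Gamma>) / 4 - 28 * (4 * \<sigma>\<^sup>2) / N)"
    using N by (intro mult_left_mono) auto
  also have "\<dots> \<le> Q.expectation (\<lambda>z. exp (- (?R z / \<gamma>\<^sup>2)) - exp (- ((?R z + 2 * ?X z + N) / \<gamma>\<^sup>2)))"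
    using g N C Q_norm(1) Q_linear[of e] order.trans[OF Q_norm(2) Gam]
    by (intro Q.kernel_gap_mean) (auto simp: sum_nonneg N_def)
  also have "\<dots> = Q.expectation (\<lambda>z. shift_kernel \<gamma> d (\<lambda>_. 0) (fst z) (snd z) - shift_kernel \<gamma> d e (fst z) (snd z))"
    by (simp add: shift_kernel_expand N_def)
  also have "\<dots> = Q.expectation (\<lambda>z. shift_kernel \<gamma> d (\<lambda>_. 0) (fst z) (snd z)) - Q.expectation (\<lambda>z. shift_kernel \<gamma> d e (fst z) (snd z))"
    by (intro Bochner_Integration.integral_diff Q_kernel_integrable)
  finally show ?thesis .
qed

text \<open>
  With \<open>R - 2 \<sigma>\<^sup>2 d\<close>, \<open>2 X\<close> and \<open>\<parallel>e\<parallel>\<^sup>2\<close> as the three parts of the exponent's deviation, this is three times the sum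
  of the bounds on their second moments, relative to \<open>N\<^sup>2\<close>.
\<close>
definition fluctuation_const :: real where
  "fluctuation_const = 3 * (6 * m4 + 12 * \<sigma> ^ 4) + 48 * \<sigma>\<^sup>2 + 3"

text \<open>
  Compares every kernel value in \<open>h\<close>, shifted or not, with the constant that belongs to the typical squared
  distance \<open>2 \<sigma>\<^sup>2 d\<close> of two unshifted vectors.
\<close>
lemma Q_kernel_fluctuation:
  fixes e :: "nat \<Rightarrow> real" and N :: real
  assumes g: "\<gamma> > 0" and N: "1 \<le> N" "real d \<le> N" "(\<Sum>b<d. (e b)\<^sup>2) \<le> N"
  shows "(\<integral>z. (shift_kernel \<gamma> d e (fst z) (snd z) - exp (- (2 * \<sigma>\<^sup>2 * real d / \<gamma>\<^sup>2)))\<^sup>2 \<partial>Q)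
       \<le> fluctuation_const * (min 1 (N / \<gamma>\<^sup>2))\<^sup>2"
proof -
  interpret Q: prob_space Q by (rule prob_space_Q)
  let ?R = "\<lambda>z::(nat \<Rightarrow> real) \<times> (nat \<Rightarrow> real). \<Sum>b<d. (fst z b - snd z b)\<^sup>2"
  let ?X = "\<lambda>z::(nat \<Rightarrow> real) \<times> (nat \<Rightarrow> real). \<Sum>b<d. e b * (fst z b - snd z b)"
  let ?n = "\<Sum>b<d. (e b)\<^sup>2"
  let ?\<rho> = "2 * \<sigma>\<^sup>2 * real d"
  define Y where "Y z = ?R z + 2 * ?X z + ?n" for z
  have Y_nonneg: "0 \<le> Y z" for z
  proof -
    have "Y z = (\<Sum>b<d. (fst z b - snd z b + e b)\<^sup>2)"
      unfolding shifted_square_sum Y_def ..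
    then show ?thesis by (simp add: sum_nonneg)
  qed
  have n: "0 \<le> ?n" by (simp add: sum_nonneg)
  have Y_meas: "Y \<in> borel_measurable Q"
    unfolding Y_def[abs_def] using Q_norm(1) Q_linear(1)[of e] by auto
  have le: "(Y z - ?\<rho>)\<^sup>2 \<le> 3 * (?R z - ?\<rho>)\<^sup>2 + 12 * (?X z)\<^sup>2 + 3 * N\<^sup>2" for z
  proof -
    have three: "(a + 2 * b + c)\<^sup>2 \<le> 3 * a\<^sup>2 + 12 * b\<^sup>2 + 3 * c\<^sup>2" for a b c :: real
      using zero_le_power2[of "a - c"] zero_le_power2[of "a - 2 * b"] zero_le_power2[of "c - 2 * b"]
      by (simp add: power2_eq_square algebra_simps)
    have "Y z - ?\<rho> = (?R z - ?\<rho>) + 2 * ?X z + ?n" by (simp add: Y_def)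
    then have "(Y z - ?\<rho>)\<^sup>2 \<le> 3 * (?R z - ?\<rho>)\<^sup>2 + 12 * (?X z)\<^sup>2 + 3 * ?n\<^sup>2"
      by (simp only: three)
    moreover have "?n\<^sup>2 \<le> N\<^sup>2" using n N(3) by (intro power_mono) auto
    ultimately show ?thesis by linarith
  qed
  have int: "integrable Q (\<lambda>z. 3 * (?R z - ?\<rho>)\<^sup>2 + 12 * (?X z)\<^sup>2 + 3 * N\<^sup>2)"
    using Q_norm(3) Q_linear(2)[of e] by simp
  have intY: "integrable Q (\<lambda>z. (Y z - ?\<rho>)\<^sup>2)"
    by (rule Bochner_Integration.integrable_bound[OF int])
       (use le Y_meas in \<open>auto intro: order.trans\<close>)
  have "Q.expectation (\<lambda>z. (Y z - ?\<rho>)\<^sup>2) \<le> Q.expectation (\<lambda>z. 3 * (?R z - ?\<rho>)\<^sup>2 + 12 * (?X z)\<^sup>2 + 3 * N\<^sup>2)"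
    by (intro integral_mono intY int le)
  also have "\<dots> = 3 * Q.expectation (\<lambda>z. (?R z - ?\<rho>)\<^sup>2) + 12 * Q.expectation (\<lambda>z. (?X z)\<^sup>2) + 3 * N\<^sup>2"
    using Q_norm(3) Q_linear(2)[of e] by (simp add: Q.prob_space)
  also have "\<dots> \<le> 3 * ((6 * m4 + 12 * \<sigma> ^ 4) * N\<^sup>2) + 12 * (4 * \<sigma>\<^sup>2 * N\<^sup>2) + 3 * N\<^sup>2"
  proof -
    have NN: "N \<le> N\<^sup>2" using N(1) by (simp add: self_le_power)
    have "Q.expectation (\<lambda>z. (?R z - ?\<rho>)\<^sup>2) \<le> (6 * m4 + 12 * \<sigma> ^ 4) * N\<^sup>2"
      using Q_norm(4) fourth_moment_nonneg N(2) NN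
      by (elim order.trans, intro mult_left_mono) auto
    moreover have "Q.expectation (\<lambda>z. (?X z)\<^sup>2) \<le> 4 * \<sigma>\<^sup>2 * N\<^sup>2"
      using Q_linear(3)[of e] N(3) NN by (elim order.trans, intro mult_left_mono) auto
    ultimately show ?thesis by linarith
  qed
  also have "\<dots> = fluctuation_const * N\<^sup>2"
    by (simp add: fluctuation_const_def algebra_simps)
  finally have EY: "Q.expectation (\<lambda>z. (Y z - ?\<rho>)\<^sup>2) \<le> fluctuation_const * N\<^sup>2" .
  have "1 \<le> fluctuation_const"
    using fourth_moment_nonneg by (simp add: fluctuation_const_def)
  then have "Q.expectation (\<lambda>z. (exp (- (Y z / \<gamma>\<^sup>2)) - exp (- (?\<rho> / \<gamma>\<^sup>2)))\<^sup>2)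
      \<le> fluctuation_const * (min 1 (N / \<gamma>\<^sup>2))\<^sup>2"
    using g N(1) by (intro Q.kernel_fluctuation[OF _ Y_nonneg _ _ _ Y_meas intY EY]) auto
  then show ?thesis
    by (simp add: shift_kernel_expand Y_def)
qed

end

lemma (in prob_space) indep_pair_distr:
  assumes indep: "indep_vars (\<lambda>_. N) Z J" and ij: "i \<in> J" "j \<in> J" "i \<noteq> j"
  shows "distr M (N \<Otimes>\<^sub>M N) (\<lambda>\<omega>. (Z i \<omega>, Z j \<omega>)) = distr M N (Z i) \<Otimes>\<^sub>M distr M N (Z j)"
proof -
  have "indep_var (Pi\<^sub>M {i} (\<lambda>_. N)) (\<lambda>\<omega>. restrict (\<lambda>k. Z k \<omega>) {i}) (Pi\<^sub>M {j} (\<lambda>_. N)) (\<lambda>\<omega>. restrict (\<lambda>k. Z k \<omega>) {j})"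
    by (rule indep_var_restrict[OF indep]) (use ij in auto)
  then have "indep_var N ((\<lambda>f. f i) \<circ> (\<lambda>\<omega>. restrict (\<lambda>k. Z k \<omega>) {i})) N ((\<lambda>f. f j) \<circ> (\<lambda>\<omega>. restrict (\<lambda>k. Z k \<omega>) {j}))"
    by (rule indep_var_compose) auto
  then have "indep_var N (Z i) N (Z j)"
    by (simp add: comp_def)
  then show ?thesis
    by (simp add: indep_var_distribution_eq)
qed

lemma (in prob_space) indep_quadruple_distr:
  assumes indep: "indep_vars (\<lambda>_. N) Z J"
    and J: "i \<in> J" "j \<in> J" "k \<in> J" "l \<in> J" and distinct: "distinct [i, j, k, l]"
  shows "distr M ((N \<Otimes>\<^sub>M N) \<Otimes>\<^sub>M (N \<Otimes>\<^sub>M N)) (\<lambda>\<omega>. ((Z i \<omega>, Z j \<omega>), (Z k \<omega>, Z l \<omega>)))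
       = (distr M N (Z i) \<Otimes>\<^sub>M distr M N (Z j)) \<Otimes>\<^sub>M (distr M N (Z k) \<Otimes>\<^sub>M distr M N (Z l))"
proof -
  have "indep_var (Pi\<^sub>M {i, j} (\<lambda>_. N)) (\<lambda>\<omega>. restrict (\<lambda>r. Z r \<omega>) {i, j}) (Pi\<^sub>M {k, l} (\<lambda>_. N)) (\<lambda>\<omega>. restrict (\<lambda>r. Z r \<omega>) {k, l})"
    by (rule indep_var_restrict[OF indep]) (use J distinct in auto)
  then have "indep_var (N \<Otimes>\<^sub>M N) ((\<lambda>f. (f i, f j)) \<circ> (\<lambda>\<omega>. restrict (\<lambda>r. Z r \<omega>) {i, j}))
      (N \<Otimes>\<^sub>M N) ((\<lambda>f. (f k, f l)) \<circ> (\<lambda>\<omega>. restrict (\<lambda>r. Z r \<omega>) {k, l}))"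
    by (rule indep_var_compose) auto
  then have "indep_var (N \<Otimes>\<^sub>M N) (\<lambda>\<omega>. (Z i \<omega>, Z j \<omega>)) (N \<Otimes>\<^sub>M N) (\<lambda>\<omega>. (Z k \<omega>, Z l \<omega>))"
    by (simp add: comp_def)
  then show ?thesis
    using distinct J by (simp add: indep_var_distribution_eq indep_pair_distr[OF indep])
qed

section \<open>Mean, second moment and atoms of \<open>h\<close>\<close>

lemma shift_kernel_restrict:
  "shift_kernel \<gamma> d e (restrict u {..<d}) (restrict v {..<d}) = shift_kernel \<gamma> d e u v"
  by (simp add: shift_kernel_def)

lemma latent_h_restrict:
  "latent_h \<gamma> d e (restrict s {..<d}) (restrict s' {..<d}) (restrict t {..<d}) (restrict t' {..<d})
     = latent_h \<gamma> d e s s' t t'"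
  by (simp add: latent_h_def shift_kernel_restrict)

context centred_law
begin

abbreviation B :: "(nat \<Rightarrow> real) measure" where
  "B \<equiv> Pi\<^sub>M {..<d} (\<lambda>_. borel)"

lemma sets_B: "sets V = sets B"
  by (intro sets_PiM_cong) (simp_all add: L)

text \<open>
  The mean is exact because each of the four kernel values depends on two distinct latent vectors, whose joint
  law is \<open>Q\<close>. For the second moment the same constant is subtracted from all four values; it cancels in \<open>h\<close>.
\<close>
lemma latent_h_moments:
  fixes M :: "'w measure" and Z :: "'i \<Rightarrow> 'w \<Rightarrow> nat \<Rightarrow> real" and e :: "nat \<Rightarrow> real"
  assumes M: "prob_space M" and indep: "prob_space.indep_vars M (\<lambda>_. B) Z J"
    and law: "\<And>u. u \<in> J \<Longrightarrow> distr M B (Z u) = V"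
    and J: "i \<in> J" "j \<in> J" "k \<in> J" "l \<in> J" and distinct: "distinct [i, j, k, l]"
    and g: "\<gamma> > 0"
  defines "h \<equiv> \<lambda>\<omega>. latent_h \<gamma> d e (Z i \<omega>) (Z j \<omega>) (Z k \<omega>) (Z l \<omega>)"
  shows "integrable M (\<lambda>\<omega>. (h \<omega>)\<^sup>2)"
    and "(\<integral>\<omega>. h \<omega> \<partial>M) = 2 * ((\<integral>z. shift_kernel \<gamma> d (\<lambda>_. 0) (fst z) (snd z) \<partial>Q)
                              - (\<integral>z. shift_kernel \<gamma> d e (fst z) (snd z) \<partial>Q))"
    and "1 \<le> N \<Longrightarrow> real d \<le> N \<Longrightarrow> (\<Sum>b<d. (e b)\<^sup>2) \<le> N \<Longrightarrow>
         (\<integral>\<omega>. (h \<omega>)\<^sup>2 \<partial>M) \<le> 16 * fluctuation_const * (min 1 (N / \<gamma>\<^sup>2))\<^sup>2"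
proof -
  interpret prob_space M by fact
  have rv: "random_variable B (Z u)" if "u \<in> J" for u
    using indep that by (auto simp: indep_vars_def)
  have pair_law: "distr M (B \<Otimes>\<^sub>M B) (\<lambda>\<omega>. (Z u \<omega>, Z v \<omega>)) = Q" if "u \<in> J" "v \<in> J" "u \<noteq> v" for u v
    using indep_pair_distr[OF indep that] law that by simp
  have pair_rv: "(\<lambda>\<omega>. (Z u \<omega>, Z v \<omega>)) \<in> M \<rightarrow>\<^sub>M B \<Otimes>\<^sub>M B" if "u \<in> J" "v \<in> J" for u v
    by (intro measurable_Pair rv that)
  have transfer: "(\<integral>\<omega>. f (Z u \<omega>, Z v \<omega>) \<partial>M) = (\<integral>z. f z \<partial>Q)"
    if "f \<in> borel_measurable (B \<Otimes>\<^sub>M B)" "u \<in> J" "v \<in> J" "u \<noteq> v"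
    for f :: "(nat \<Rightarrow> real) \<times> (nat \<Rightarrow> real) \<Rightarrow> real" and u v
    using integral_distr[OF pair_rv[OF that(2,3)] that(1)] pair_law[OF that(2-4)] by simp
  have km: "(\<lambda>z. shift_kernel \<gamma> d e' (fst z) (snd z)) \<in> borel_measurable (B \<Otimes>\<^sub>M B)" for e'
    by (rule shift_kernel_measurable[OF refl]) auto
  have kM [measurable]: "(\<lambda>\<omega>. shift_kernel \<gamma> d e' (Z u \<omega>) (Z v \<omega>)) \<in> borel_measurable M"
    if "u \<in> J" "v \<in> J" for e' u v
    by (rule shift_kernel_measurable[OF refl]) (use rv that in auto)
  have kint: "integrable M (\<lambda>\<omega>. shift_kernel \<gamma> d e' (Z u \<omega>) (Z v \<omega>))" if "u \<in> J" "v \<in> J" for e' u v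
    by (rule integrable_const_bound[where B = 1])
       (use shift_kernel_bounds[of \<gamma> d e'] that in \<open>auto simp: abs_of_pos\<close>)
  have ne: "i \<noteq> j" "k \<noteq> l" "i \<noteq> l" "j \<noteq> k" using distinct by auto
  have h_meas: "h \<in> borel_measurable M"
    unfolding h_def latent_h_def using J by (intro borel_measurable_add borel_measurable_diff kM)
  have h_bound: "\<bar>h \<omega>\<bar> \<le> 2" for \<omega>
    unfolding h_def latent_h_def
    using shift_kernel_bounds[of \<gamma> d "\<lambda>_. 0" "Z i \<omega>" "Z j \<omega>"] shift_kernel_bounds[of \<gamma> d "\<lambda>_. 0" "Z k \<omega>" "Z l \<omega>"]
      shift_kernel_bounds[of \<gamma> d e "Z i \<omega>" "Z l \<omega>"] shift_kernel_bounds[of \<gamma> d e "Z j \<omega>" "Z k \<omega>"]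
    by linarith
  show h_int: "integrable M (\<lambda>\<omega>. (h \<omega>)\<^sup>2)"
  proof (rule integrable_const_bound[where B = 4])
    have "(h \<omega>)\<^sup>2 \<le> 4" for \<omega>
      using h_bound[of \<omega>] abs_le_square_iff[of "h \<omega>" 2] by simp
    then show "AE \<omega> in M. norm ((h \<omega>)\<^sup>2) \<le> 4" by simp
  qed (use h_meas in simp)
  show "(\<integral>\<omega>. h \<omega> \<partial>M) = 2 * ((\<integral>z. shift_kernel \<gamma> d (\<lambda>_. 0) (fst z) (snd z) \<partial>Q)
                              - (\<integral>z. shift_kernel \<gamma> d e (fst z) (snd z) \<partial>Q))"
    unfolding h_def latent_h_def
    using transfer[OF km J(1,2) ne(1), of "\<lambda>_. 0"] transfer[OF km J(3,4) ne(2), of "\<lambda>_. 0"]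
      transfer[OF km J(1,4) ne(3), of e] transfer[OF km J(2,3) ne(4), of e]
    by (simp add: kint J)
  assume N: "1 \<le> N" "real d \<le> N" "(\<Sum>b<d. (e b)\<^sup>2) \<le> N"
  let ?c = "exp (- (2 * \<sigma>\<^sup>2 * real d / \<gamma>\<^sup>2))"
  let ?f = "\<lambda>e' z. (shift_kernel \<gamma> d e' (fst z) (snd z) - ?c)\<^sup>2"
  let ?g = "\<lambda>e' u v \<omega>. (shift_kernel \<gamma> d e' (Z u \<omega>) (Z v \<omega>) - ?c)\<^sup>2"
  have fm: "?f e' \<in> borel_measurable (B \<Otimes>\<^sub>M B)" for e'
    using km[of e'] by simp
  have g_le: "(\<integral>\<omega>. ?g e' u v \<omega> \<partial>M) \<le> fluctuation_const * (min 1 (N / \<gamma>\<^sup>2))\<^sup>2"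
    if "u \<in> J" "v \<in> J" "u \<noteq> v" "(\<Sum>b<d. (e' b)\<^sup>2) \<le> N" for e' u v
    using transfer[OF fm that(1-3), of e'] Q_kernel_fluctuation[OF g N(1,2) that(4)] by simp
  have g_int: "integrable M (?g e' u v)" if "u \<in> J" "v \<in> J" for e' u v
  proof (rule integrable_const_bound[where B = 1])
    have "0 \<le> 2 * \<sigma>\<^sup>2 * real d / \<gamma>\<^sup>2" by simp
    then have c: "0 < ?c" "?c \<le> 1" by simp_all
    have "\<bar>shift_kernel \<gamma> d e' (Z u \<omega>) (Z v \<omega>) - ?c\<bar> \<le> 1" for \<omega>
      using shift_kernel_bounds[of \<gamma> d e' "Z u \<omega>" "Z v \<omega>"] c by linarith
    then show "AE \<omega> in M. norm (?g e' u v \<omega>) \<le> 1"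
      by (simp add: abs_square_le_1)
  qed (use that in simp)
  have h_le: "(h \<omega>)\<^sup>2 \<le> 4 * (?g (\<lambda>_. 0) i j \<omega> + ?g (\<lambda>_. 0) k l \<omega> + ?g e i l \<omega> + ?g e j k \<omega>)" for \<omega>
  proof -
    have four: "(a + b - a' - b')\<^sup>2 \<le> 4 * ((a - c)\<^sup>2 + (b - c)\<^sup>2 + (a' - c)\<^sup>2 + (b' - c)\<^sup>2)" for a b a' b' c :: real
    proof -
      have *: "(p + q - r - s)\<^sup>2 \<le> 4 * (p\<^sup>2 + q\<^sup>2 + r\<^sup>2 + s\<^sup>2)" for p q r s :: real
        using zero_le_power2[of "p - q"] zero_le_power2[of "p + r"] zero_le_power2[of "p + s"]
          zero_le_power2[of "q + r"] zero_le_power2[of "q + s"] zero_le_power2[of "r - s"]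
        by (simp add: power2_eq_square algebra_simps)
      have "(a - c) + (b - c) - (a' - c) - (b' - c) = a + b - a' - b'" by simp
      then show ?thesis using *[of "a - c" "b - c" "a' - c" "b' - c"] by (simp only:)
    qed
    show ?thesis unfolding h_def latent_h_def by (rule four)
  qed
  have "(\<integral>\<omega>. (h \<omega>)\<^sup>2 \<partial>M)
      \<le> (\<integral>\<omega>. 4 * (?g (\<lambda>_. 0) i j \<omega> + ?g (\<lambda>_. 0) k l \<omega> + ?g e i l \<omega> + ?g e j k \<omega>) \<partial>M)"
    by (intro integral_mono h_int h_le integrable_mult_right Bochner_Integration.integrable_add g_int J)
  also have "\<dots> = 4 * ((\<integral>\<omega>. ?g (\<lambda>_. 0) i j \<omega> \<partial>M) + (\<integral>\<omega>. ?g (\<lambda>_. 0) k l \<omega> \<partial>M)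
                       + (\<integral>\<omega>. ?g e i l \<omega> \<partial>M) + (\<integral>\<omega>. ?g e j k \<omega> \<partial>M))"
    using g_int J by (simp add: Bochner_Integration.integral_add Bochner_Integration.integrable_add)
  also have "\<dots> \<le> 16 * fluctuation_const * (min 1 (N / \<gamma>\<^sup>2))\<^sup>2"
    using g_le[OF J(1,2) ne(1), of "\<lambda>_. 0"] g_le[OF J(3,4) ne(2), of "\<lambda>_. 0"]
      g_le[OF J(1,4) ne(3) N(3)] g_le[OF J(2,3) ne(4) N(3)] N(1) by simp
  finally show "(\<integral>\<omega>. (h \<omega>)\<^sup>2 \<partial>M) \<le> 16 * fluctuation_const * (min 1 (N / \<gamma>\<^sup>2))\<^sup>2" .
qed

lemma latent_h_atom:
  fixes M :: "'w measure" and Z :: "'i \<Rightarrow> 'w \<Rightarrow> nat \<Rightarrow> real" and e :: "nat \<Rightarrow> real"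
  assumes M: "prob_space M" and indep: "prob_space.indep_vars M (\<lambda>_. B) Z J"
    and law: "\<And>u. u \<in> J \<Longrightarrow> distr M B (Z u) = V"
    and J: "i \<in> J" "j \<in> J" "k \<in> J" "l \<in> J" and distinct: "distinct [i, j, k, l]"
    and g: "\<gamma> > 0" and d: "d \<ge> 1" and sep: "separated_sets L r A A'"
  defines "h \<equiv> \<lambda>\<omega>. latent_h \<gamma> d e (Z i \<omega>) (Z j \<omega>) (Z k \<omega>) (Z l \<omega>)"
  shows "measure M {\<omega> \<in> space M. h \<omega> = a} \<le> 1 - (min (measure L A) (measure L A'))\<^sup>2 / 4"
proof -
  interpret prob_space M by fact
  interpret V: prob_space V by (rule prob_space_V)
  interpret Q: prob_space Q by (rule prob_space_Q)
  let ?\<rho> = "(min (measure L A) (measure L A'))\<^sup>2 / 4"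
  have rv: "random_variable B (Z u)" if "u \<in> J" for u
    using indep that by (auto simp: indep_vars_def)
  define F where "F z = (indicator (- {a})
      (latent_h \<gamma> d e (fst (snd z)) (snd (snd z)) (fst (fst z)) (snd (fst z))) :: ennreal)"
    for z :: "((nat \<Rightarrow> real) \<times> (nat \<Rightarrow> real)) \<times> ((nat \<Rightarrow> real) \<times> (nat \<Rightarrow> real))"
  have F_meas: "F \<in> borel_measurable ((B \<Otimes>\<^sub>M B) \<Otimes>\<^sub>M (B \<Otimes>\<^sub>M B))"
  proof -
    have "(\<lambda>z. latent_h \<gamma> d e (fst (snd z)) (snd (snd z)) (fst (fst z)) (snd (fst z)))
        \<in> borel_measurable ((B \<Otimes>\<^sub>M B) \<Otimes>\<^sub>M (B \<Otimes>\<^sub>M B))"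
      by (rule latent_h_measurable[OF refl]) auto
    then show ?thesis unfolding F_def[abs_def] by measurable
  qed
  have sets_QQ: "sets ((B \<Otimes>\<^sub>M B) \<Otimes>\<^sub>M (B \<Otimes>\<^sub>M B)) = sets (Q \<Otimes>\<^sub>M Q)"
    by (intro sets_pair_measure_cong sets_B[symmetric])
  have F_meas': "F \<in> borel_measurable (Q \<Otimes>\<^sub>M Q)"
    using F_meas measurable_cong_sets[OF sets_QQ refl] by blast
  have law4: "distr M ((B \<Otimes>\<^sub>M B) \<Otimes>\<^sub>M (B \<Otimes>\<^sub>M B)) (\<lambda>\<omega>. ((Z k \<omega>, Z l \<omega>), (Z i \<omega>, Z j \<omega>))) = Q \<Otimes>\<^sub>M Q"
    using indep_quadruple_distr[OF indep J(3,4,1,2)] distinct law J by auto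
  have h_meas [measurable]: "h \<in> borel_measurable M"
    unfolding h_def by (rule latent_h_measurable[OF refl]) (use rv J in auto)
  have "ennreal ?\<rho> = (\<integral>\<^sup>+ x. ennreal ?\<rho> \<partial>Q)"
    by (simp add: Q.emeasure_space_1)
  also have "\<dots> \<le> (\<integral>\<^sup>+ x. \<integral>\<^sup>+ y. F (x, y) \<partial>Q \<partial>Q)"
  proof (rule nn_integral_mono)
    fix x assume x: "x \<in> space Q"
    have Fx: "(\<lambda>y. F (x, y)) \<in> borel_measurable Q"
      using measurable_compose[OF measurable_Pair1'[OF x] F_meas'] .
    have "ennreal ?\<rho> \<le> (\<integral>\<^sup>+ s. \<integral>\<^sup>+ s'. indicator (- {a}) (latent_h \<gamma> d e s s' (fst x) (snd x)) \<partial>V \<partial>V)"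
      using x by (intro latent_h_not_concentrated[OF L sep d g]) (auto simp: space_pair_measure)
    also have "\<dots> = (\<integral>\<^sup>+ y. F (x, y) \<partial>Q)"
      by (subst V.nn_integral_fst[OF Fx, symmetric]) (simp add: F_def)
    finally show "ennreal ?\<rho> \<le> (\<integral>\<^sup>+ y. F (x, y) \<partial>Q)" .
  qed
  also have "\<dots> = (\<integral>\<^sup>+ z. F z \<partial>(Q \<Otimes>\<^sub>M Q))"
    by (rule Q.nn_integral_fst[OF F_meas'])
  also have "\<dots> = (\<integral>\<^sup>+ \<omega>. F ((Z k \<omega>, Z l \<omega>), (Z i \<omega>, Z j \<omega>)) \<partial>M)"
    unfolding law4[symmetric]
    by (subst nn_integral_distr; (intro measurable_Pair rv J)?) (simp_all add: F_meas)
  also have "\<dots> = (\<integral>\<^sup>+ \<omega>. indicator {\<omega> \<in> space M. h \<omega> \<noteq> a} \<omega> \<partial>M)"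
    by (intro nn_integral_cong) (auto simp: F_def h_def indicator_def)
  also have "\<dots> = ennreal (prob {\<omega> \<in> space M. h \<omega> \<noteq> a})"
    by (simp add: emeasure_eq_measure)
  finally have "?\<rho> \<le> prob {\<omega> \<in> space M. h \<omega> \<noteq> a}"
    by (subst (asm) ennreal_le_iff) auto
  also have "\<dots> = 1 - prob {\<omega> \<in> space M. h \<omega> = a}"
    by (rule prob_neg) simp
  finally show ?thesis by simp
qed

end

section \<open>Power of the linear-time test\<close>

context centred_law
begin

text \<open>
  A bound for a single index of the sequence. Its constants depend on the coordinate law, \<open>\<Gamma>\<close> and \<open>\<alpha>\<close> only, which is
  what makes it uniform along the sequence. The factor \<open>256\<close> is \<open>16\<close>, from the second moment, times the inverse
  square of the \<open>1 / 4\<close> in the lower bound \<open>w exp (- \<Gamma>) / 4\<close> for the mean.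
\<close>
lemma location_model_reject_prob_ge:
  fixes M :: "'w measure" and \<alpha> :: real
  assumes model: "location_model L M n d U \<mu>P \<mu>Q s t x y"
    and m: "n = 2 * m" "m \<ge> 1" and d: "d \<ge> 1" and g: "\<gamma> > 0"
    and Gam: "4 * \<sigma>\<^sup>2 * real d \<le> \<Gamma> * \<gamma>\<^sup>2"
    and N: "N = (\<Sum>a<d. (\<mu>P a - \<mu>Q a)\<^sup>2)" "1 \<le> N" "real d \<le> N" "896 * \<sigma>\<^sup>2 * exp \<Gamma> \<le> N"
    and sep: "separated_sets L r A A'"
  defines "K \<equiv> 256 * fluctuation_const * (exp \<Gamma>)\<^sup>2"
    and "q \<equiv> 1 - (min (measure L A) (measure L A'))\<^sup>2 / 4"
    and "z \<equiv> z_upper \<alpha>"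
  shows "1 - (q ^ (m - 1) + 4 * K / real m + 4 * K * z\<^sup>2 / real m) \<le> reject_prob M n d \<gamma> \<alpha> x y"
proof -
  define Z where "Z u \<omega> = restrict (case_sum s t u \<omega>) {..<d}" for u \<omega>
  let ?J = "{1..n} <+> {1..n}"
  interpret prob_space M
    using model by (simp add: location_model_def)
  have U: "orthogonal_upto d U"
    and indep: "indep_vars (\<lambda>_. B) Z ?J"
    and coord: "\<And>u. u \<in> ?J \<Longrightarrow> indep_vars (\<lambda>_. borel) (\<lambda>b \<omega>. case_sum s t u \<omega> b) {..<d}"
    and coord_law: "\<And>u b. u \<in> ?J \<Longrightarrow> b < d \<Longrightarrow> distr M borel (\<lambda>\<omega>. case_sum s t u \<omega> b) = L"
    and xy: "\<And>i \<omega> a. i \<in> {1..n} \<Longrightarrow> \<omega> \<in> space M \<Longrightarrow> a < d \<Longrightarrow>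
         x i \<omega> a = mat_vec d U (s i \<omega>) a + \<mu>P a \<and> y i \<omega> a = mat_vec d U (t i \<omega>) a + \<mu>Q a"
    using model unfolding location_model_def iid_vars_def Z_def[abs_def] by blast+
  have law: "distr M B (Z u) = V" if u: "u \<in> ?J" for u
  proof -
    have rv: "random_variable borel (\<lambda>\<omega>. case_sum s t u \<omega> b)" if "b \<in> {..<d}" for b
      using coord[OF u] that by (auto simp: indep_vars_def)
    have "distr M B (\<lambda>\<omega>. \<lambda>b\<in>{..<d}. case_sum s t u \<omega> b)
        = (\<Pi>\<^sub>M b\<in>{..<d}. distr M borel (\<lambda>\<omega>. case_sum s t u \<omega> b))"
      using indep_vars_iff_distr_eq_PiM'[of "{..<d}" "\<lambda>b \<omega>. case_sum s t u \<omega> b" "\<lambda>_. borel"] rv coord[OF u] d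
      by (auto simp: lessThan_empty_iff)
    also have "\<dots> = V"
      by (intro PiM_cong refl) (use coord_law[OF u] in auto)
    finally show ?thesis by (simp add: Z_def[abs_def])
  qed
  define e where "e b = (\<Sum>c<d. U c b * (\<mu>P c - \<mu>Q c))" for b
  have e_norm: "(\<Sum>b<d. (e b)\<^sup>2) = N"
  proof -
    have "(\<Sum>b<d. (e b)\<^sup>2) = (\<Sum>a<d. (mat_vec d U e a)\<^sup>2)"
      by (rule orthogonal_norm[OF U, symmetric])
    also have "\<dots> = N"
      unfolding N(1) e_def
      by (intro sum.cong refl) (simp add: orthogonal_mat_vec_transpose[OF U, of _ "\<lambda>c. \<mu>P c - \<mu>Q c"])
    finally show ?thesis .
  qed
  define h where "h i \<omega> = latent_h \<gamma> d e (Z (Inl (2 * i - 1)) \<omega>) (Z (Inl (2 * i)) \<omega>)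
                                         (Z (Inr (2 * i - 1)) \<omega>) (Z (Inr (2 * i)) \<omega>)" for i \<omega>
  have in_J: "Inl (2 * i - 1) \<in> ?J" "Inl (2 * i) \<in> ?J" "Inr (2 * i - 1) \<in> ?J" "Inr (2 * i) \<in> ?J"
    and dist: "distinct [Inl (2 * i - 1), Inl (2 * i), Inr (2 * i - 1), Inr (2 * i) :: nat + nat]"
    if "i \<in> {1..m}" for i
    using that m by auto
  have h_eq: "mmd_h (gauss_kernel \<gamma> d) (x (2 * i - 1) \<omega>, y (2 * i - 1) \<omega>) (x (2 * i) \<omega>, y (2 * i) \<omega>) = h i \<omega>"
    if "i \<in> {1..m}" "\<omega> \<in> space M" for i \<omega>
  proof -
    have i: "2 * i - 1 \<in> {1..n}" "2 * i \<in> {1..n}" using that m by auto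
    have "mmd_h (gauss_kernel \<gamma> d) (x (2 * i - 1) \<omega>, y (2 * i - 1) \<omega>) (x (2 * i) \<omega>, y (2 * i) \<omega>)
        = latent_h \<gamma> d e (s (2 * i - 1) \<omega>) (s (2 * i) \<omega>) (t (2 * i - 1) \<omega>) (t (2 * i) \<omega>)"
      unfolding e_def using xy[OF i(1) that(2)] xy[OF i(2) that(2)] by (intro mmd_h_rotated U) auto
    also have "\<dots> = h i \<omega>"
      by (simp add: h_def Z_def latent_h_restrict)
    finally show ?thesis .
  qed
  let ?gap = "(\<integral>z. shift_kernel \<gamma> d (\<lambda>_. 0) (fst z) (snd z) \<partial>Q) - (\<integral>z. shift_kernel \<gamma> d e (fst z) (snd z) \<partial>Q)"
  let ?w = "min 1 (N / \<gamma>\<^sup>2)"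
  define \<mu> where "\<mu> = 2 * ?gap"
  have w: "0 < ?w" using N(2) g by simp
  have mu_ge: "?w * (exp (- \<Gamma>) / 4) \<le> \<mu>"
    using Q_kernel_gap[of \<gamma> e \<Gamma>] g N(2,4) Gam unfolding e_norm \<mu>_def by simp
  have mu_pos: "0 < \<mu>"
    using w mu_ge by (elim less_le_trans[rotated]) simp
  have tau: "0 \<le> fluctuation_const"
    using fourth_moment_nonneg by (simp add: fluctuation_const_def)
  have w_mu: "16 * fluctuation_const * ?w\<^sup>2 \<le> K * \<mu>\<^sup>2"
  proof -
    have "(?w * (exp (- \<Gamma>) / 4))\<^sup>2 \<le> \<mu>\<^sup>2"
      using mu_ge w by (intro power_mono) auto
    then have "K * (?w * (exp (- \<Gamma>) / 4))\<^sup>2 \<le> K * \<mu>\<^sup>2"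
      using tau by (intro mult_left_mono) (auto simp: K_def)
    moreover have "K * (?w * (exp (- \<Gamma>) / 4))\<^sup>2 = 16 * fluctuation_const * ?w\<^sup>2 * (exp \<Gamma> * exp (- \<Gamma>))\<^sup>2"
      by (simp add: K_def power_mult_distrib power_divide)
    moreover have "exp \<Gamma> * exp (- \<Gamma>) = 1"
      by (simp add: exp_add[symmetric])
    ultimately show ?thesis by simp
  qed
  note moments = latent_h_moments[OF prob_space_axioms indep law in_J dist g]
  have h_indep: "indep_vars (\<lambda>_. borel) h {1..m}"
  proof -
    define K' where "K' i = {Inl (2 * i - 1), Inl (2 * i), Inr (2 * i - 1), Inr (2 * i)}" for i :: nat
    define Y where "Y i f = latent_h \<gamma> d e (f (Inl (2 * i - 1))) (f (Inl (2 * i)))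
        (f (Inr (2 * i - 1))) (f (Inr (2 * i)))" for i and f :: "nat + nat \<Rightarrow> nat \<Rightarrow> real"
    have "indep_vars (\<lambda>i. Pi\<^sub>M (K' i) (\<lambda>_. B)) (\<lambda>i \<omega>. restrict (\<lambda>u. Z u \<omega>) (K' i)) {1..m}"
    proof (rule indep_vars_restrict[OF indep])
      show "K' i \<subseteq> ?J" if "i \<in> {1..m}" for i
        using in_J[OF that] by (simp add: K'_def)
      show "disjoint_family_on K' {1..m}"
        by (auto simp: disjoint_family_on_def K'_def)
    qed
    then have "indep_vars (\<lambda>_. borel) (\<lambda>i \<omega>. Y i (restrict (\<lambda>u. Z u \<omega>) (K' i))) {1..m}"
    proof (rule indep_vars_compose2)
      show "Y i \<in> borel_measurable (Pi\<^sub>M (K' i) (\<lambda>_. B))" for i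
        unfolding Y_def[abs_def]
        by (intro latent_h_measurable[OF refl] measurable_component_singleton) (auto simp: K'_def)
    qed
    then show ?thesis
      by (simp add: Y_def K'_def h_def[abs_def])
  qed
  have "1 - (q ^ (m - 1) + 4 * K / real m + 4 * K * z\<^sup>2 / real m)
      \<le> prob {\<omega> \<in> space M. z < sqrt (2 * real m) * (1 / real m * (\<Sum>i=1..m. h i \<omega>)) /
           sqrt (2 * (1 / real m * (\<Sum>i=1..m. (h i \<omega> - 1 / real m * (\<Sum>i=1..m. h i \<omega>))\<^sup>2)))}"
  proof (rule prob_studentized_ratio_gt[OF m(2) mu_pos h_indep])
    fix i assume i: "i \<in> {1..m}"
    show "integrable M (\<lambda>\<omega>. (h i \<omega>)\<^sup>2)"
      unfolding h_def by (rule moments(1)[OF _ i i i i i])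
    show "expectation (h i) = \<mu>"
      unfolding h_def[abs_def] \<mu>_def by (rule moments(2)[OF _ i i i i i])
    show "expectation (\<lambda>\<omega>. (h i \<omega>)\<^sup>2) \<le> K * \<mu>\<^sup>2"
      unfolding h_def by (rule order.trans[OF moments(3)[OF _ i i i i i N(2,3)] w_mu]) (simp_all add: e_norm)
    show "prob {\<omega> \<in> space M. h i \<omega> = a} \<le> q" for a
      unfolding h_def q_def
      by (rule latent_h_atom[OF prob_space_axioms indep law in_J dist g d sep]) (use i in auto)
  qed
  also have "\<dots> = reject_prob M n d \<gamma> \<alpha> x y"
  proof -
    have n: "n div 2 = m" "real n / 2 = real m" "real n = 2 * real m" using m by auto
    have mmd: "linear_mmd (gauss_kernel \<gamma> d) n (\<lambda>i. (x i \<omega>, y i \<omega>)) = 1 / real m * (\<Sum>i=1..m. h i \<omega>)"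
      if "\<omega> \<in> space M" for \<omega>
      unfolding linear_mmd_def n(1,2)
      by (intro arg_cong2[where f = "(*)"] sum.cong refl) (rule h_eq[OF _ that])
    have var: "linear_mmd_var (gauss_kernel \<gamma> d) n (\<lambda>i. (x i \<omega>, y i \<omega>))
        = 2 * (1 / real m * (\<Sum>i=1..m. (h i \<omega> - 1 / real m * (\<Sum>i=1..m. h i \<omega>))\<^sup>2))"
      if "\<omega> \<in> space M" for \<omega>
      unfolding linear_mmd_var_def mmd[OF that] n(1,2)
      by (intro arg_cong2[where f = "(*)"] sum.cong refl) (simp only: h_eq[OF _ that])
    show ?thesis
      unfolding reject_prob_def z_def n(3)
      by (intro arg_cong[where f = "measure M"] Collect_cong conj_cong refl) (simp add: mmd var)
  qed
  finally show ?thesis .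
qed

end

theorem corollary2:
  fixes n d :: "nat \<Rightarrow> nat"
    and L :: "real measure" and \<sigma> \<alpha> :: real
    and M :: "nat \<Rightarrow> 'w measure"
    and U :: "nat \<Rightarrow> nat \<Rightarrow> nat \<Rightarrow> real"
    and \<mu>P \<mu>Q :: "nat \<Rightarrow> nat \<Rightarrow> real"
    and s t x y :: "nat \<Rightarrow> nat \<Rightarrow> 'w \<Rightarrow> nat \<Rightarrow> real"
    and \<gamma> \<Psi> :: "nat \<Rightarrow> real"
  assumes "\<And>k. even (n k)"
    and "filterlim n at_top sequentially"
    and "filterlim d at_top sequentially"
    and "zero_mean_law L"
    and "\<And>k. location_model L (M k) (n k) (d k) (U k) (\<mu>P k) (\<mu>Q k) (s k) (t k) (x k) (y k)"
    and "central_moments_2_to_6 L"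
    and "\<sigma> > 0" and "prob_space.variance L (\<lambda>x. x) = \<sigma>\<^sup>2"
    and "\<And>k. \<gamma> k > 0"
    and "\<exists>c'>0. \<forall>k. \<gamma> k \<ge> c' * sqrt (real (d k))"
    and "0 < \<alpha>" and "\<alpha> < 1"
    and "\<And>k. \<Psi> k = snr (d k) (\<mu>P k) (\<mu>Q k) \<sigma>"
    and "filterlim (\<lambda>k. \<Psi> k / sqrt (real (d k))) at_top sequentially"
  shows "(\<exists>c C. 0 < c \<and> c \<le> C \<and>
            (\<exists>ck :: nat \<Rightarrow> real. (\<forall>k. ck k \<in> {c..C}) \<and>
              (\<lambda>k. reject_prob (M k) (n k) (d k) (\<gamma> k) \<alpha> (x k) (y k)
                     - std_normal_cdf (ck k * sqrt (real (n k)) * \<Psi> k - z_upper \<alpha>))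
                \<longlonglongrightarrow> 0)) \<and>
         (\<lambda>k. reject_prob (M k) (n k) (d k) (\<gamma> k) \<alpha> (x k) (y k)) \<longlonglongrightarrow> 1"
proof -
  let ?power = "\<lambda>k. reject_prob (M k) (n k) (d k) (\<gamma> k) \<alpha> (x k) (y k)"
  let ?z = "z_upper \<alpha>"
  have L: "prob_space L" "sets L = sets borel" "integrable L (\<lambda>x. x)" "(\<integral>x. x \<partial>L) = 0"
    using assms(4) by (auto simp: zero_mean_law_def)
  have moment: "integrable L (\<lambda>x. x ^ r)" if "r \<in> {2..6}" for r
    using assms(6) that unfolding central_moments_2_to_6_def L(4) by auto
  have var: "(\<integral>x. x\<^sup>2 \<partial>L) = \<sigma>\<^sup>2"
    using assms(8) unfolding L(4) by simp
  have law: "centred_law L \<sigma> (\<integral>x. x ^ 4 \<partial>L)"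
    by (intro centred_law.intro L var refl moment) simp_all
  have "prob_space.variance L (\<lambda>x. x) > 0"
    using assms(7,8) by simp
  then have "\<exists>r A B. separated_sets L r A B"
    by (rule separated_sets_exist[OF L])
  then obtain r A A' where sep: "separated_sets L r A A'"
    by blast
  obtain c' where c': "c' > 0" "\<And>k. c' * sqrt (real (d k)) \<le> \<gamma> k"
    using assms(10) by blast
  define \<Gamma> where "\<Gamma> = 4 * \<sigma>\<^sup>2 / c'\<^sup>2"
  have Gam: "4 * \<sigma>\<^sup>2 * real (d k) \<le> \<Gamma> * (\<gamma> k)\<^sup>2" for k
  proof -
    have "(c' * sqrt (real (d k)))\<^sup>2 \<le> (\<gamma> k)\<^sup>2"
      using c' by (intro power_mono) auto
    then have "\<Gamma> * (c'\<^sup>2 * real (d k)) \<le> \<Gamma> * (\<gamma> k)\<^sup>2"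
      by (intro mult_left_mono) (auto simp: power_mult_distrib \<Gamma>_def)
    then show ?thesis
      using c'(1) by (simp add: \<Gamma>_def)
  qed
  define m where "m k = n k div 2" for k
  have n: "n k = 2 * m k" for k
    using assms(1)[of k] by (simp add: m_def)
  have m_lim: "filterlim m at_top sequentially"
  proof (subst filterlim_at_top, intro allI)
    fix T
    show "eventually (\<lambda>k. T \<le> m k) sequentially"
      using filterlim_at_top[THEN iffD1, OF assms(2), rule_format, of "2 * T"]
      by eventually_elim (simp add: m_def)
  qed
  define N where "N k = (\<Sum>a<d k. (\<mu>P k a - \<mu>Q k a)\<^sup>2)" for k
  have N_Psi: "N k = \<sigma>\<^sup>2 * (\<Psi> k)\<^sup>2" for k
    unfolding N_def euclidean_norm_square[symmetric] assms(13) snr_def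
    using assms(7) by (simp add: power_divide)
  have Psi_nonneg: "0 \<le> \<Psi> k" for k
    using assms(7) by (simp add: assms(13) snr_def euclidean_norm_def)
  have N_large: "eventually (\<lambda>k. T * real (d k) \<le> N k) sequentially" if "T \<ge> 0" for T
  proof -
    have "eventually (\<lambda>k. sqrt T / \<sigma> \<le> \<Psi> k / sqrt (real (d k))) sequentially"
      using filterlim_at_top[THEN iffD1, OF assms(14)] by blast
    moreover have "eventually (\<lambda>k. 1 \<le> d k) sequentially"
      using filterlim_at_top[THEN iffD1, OF assms(3)] by blast
    ultimately show ?thesis
    proof eventually_elim
      case (elim k)
      have "sqrt T * sqrt (real (d k)) \<le> \<sigma> * \<Psi> k"
        using elim assms(7) by (simp add: field_simps)
      then have "(sqrt T * sqrt (real (d k)))\<^sup>2 \<le> (\<sigma> * \<Psi> k)\<^sup>2"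
        using that by (intro power_mono) auto
      then show ?case
        using that by (simp add: power_mult_distrib N_Psi)
    qed
  qed
  define q where "q = 1 - (min (measure L A) (measure L A'))\<^sup>2 / 4"
  define K where "K = 256 * centred_law.fluctuation_const \<sigma> (\<integral>x. x ^ 4 \<partial>L) * (exp \<Gamma>)\<^sup>2"
  have q: "0 \<le> q" "q < 1"
  proof -
    let ?\<rho> = "min (measure L A) (measure L A')"
    have "0 < ?\<rho>" "?\<rho> \<le> 1"
      using sep prob_space.prob_le_1[OF L(1)] by (auto simp: separated_sets_def min_def)
    then have "0 < ?\<rho>\<^sup>2" "?\<rho>\<^sup>2 \<le> 1"
      by (auto intro!: zero_less_power power_le_one simp del: zero_less_power_eq min_less_iff_conj)
    then show "0 \<le> q" "q < 1" by (simp_all add: q_def)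
  qed
  have lower: "eventually (\<lambda>k. 1 - (q ^ (m k - 1) + 4 * K / real (m k) + 4 * K * ?z\<^sup>2 / real (m k)) \<le> ?power k) sequentially"
  proof -
    have "eventually (\<lambda>k. 1 \<le> d k) sequentially" "eventually (\<lambda>k. 1 \<le> m k) sequentially"
      using filterlim_at_top[THEN iffD1, OF assms(3)] filterlim_at_top[THEN iffD1, OF m_lim] by blast+
    moreover have "eventually (\<lambda>k. (1 + 896 * \<sigma>\<^sup>2 * exp \<Gamma>) * real (d k) \<le> N k) sequentially"
      by (intro N_large) simp
    ultimately show ?thesis
    proof eventually_elim
      case (elim k)
      define c where "c = 896 * \<sigma>\<^sup>2 * exp \<Gamma>"
      have c: "0 \<le> c" by (simp add: c_def)
      have large: "(1 + c) * real (d k) \<le> N k"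
        using elim(3) by (simp only: c_def)
      have "(1 + c) * 1 \<le> N k" "1 * real (d k) \<le> N k"
        by (rule order.trans[OF _ large], use elim(1) c in \<open>intro mult_left_mono mult_right_mono; simp\<close>)+
      then have "1 \<le> N k \<and> real (d k) \<le> N k \<and> c \<le> N k"
        using c by auto
      then have "1 \<le> N k" "real (d k) \<le> N k" "896 * \<sigma>\<^sup>2 * exp \<Gamma> \<le> N k"
        by (simp_all add: c_def)
      then show ?case
        unfolding K_def q_def using elim(1,2)
        by (intro centred_law.location_model_reject_prob_ge[OF law assms(5) n _ _ assms(9) Gam N_def _ _ _ sep])
    qed
  qed
  have upper: "?power k \<le> 1" for k
  proof -
    interpret prob_space "M k"
      using assms(5)[of k] by (simp add: location_model_def)
    show ?thesis unfolding reject_prob_def by simp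
  qed
  have m_real: "filterlim (\<lambda>k. real (m k)) at_top sequentially"
    by (rule filterlim_compose[OF filterlim_real_sequentially m_lim])
  have "(\<lambda>k. q ^ (m k - 1)) \<longlonglongrightarrow> 0"
  proof -
    have "filterlim (\<lambda>k. m k - 1) at_top sequentially"
      using filterlim_compose[OF filterlim_minus_const_nat_at_top m_lim] .
    then show ?thesis
      using filterlim_compose[OF LIMSEQ_power_zero[of q]] q by auto
  qed
  moreover have "(\<lambda>k. c / real (m k)) \<longlonglongrightarrow> 0" for c
    by (rule tendsto_divide_0[OF tendsto_const filterlim_at_top_imp_at_infinity[OF m_real]])
  ultimately have "(\<lambda>k. 1 - (q ^ (m k - 1) + 4 * K / real (m k) + 4 * K * ?z\<^sup>2 / real (m k))) \<longlonglongrightarrow> 1 - (0 + 0 + 0)"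
    by (intro tendsto_intros)
  then have power: "?power \<longlonglongrightarrow> 1"
    using lower by (intro tendsto_sandwich[OF lower _ _ tendsto_const]) (auto simp: upper)
  have "filterlim (\<lambda>k. 1 * sqrt (real (n k)) * \<Psi> k - ?z) at_top sequentially"
  proof (subst filterlim_at_top, intro allI)
    fix T
    have "eventually (\<lambda>k. \<bar>T + ?z\<bar> \<le> \<Psi> k / sqrt (real (d k))) sequentially"
      using filterlim_at_top[THEN iffD1, OF assms(14)] by blast
    moreover have "eventually (\<lambda>k. 1 \<le> d k) sequentially" "eventually (\<lambda>k. 1 \<le> n k) sequentially"
      using filterlim_at_top[THEN iffD1, OF assms(3)] filterlim_at_top[THEN iffD1, OF assms(2)] by blast+
    ultimately show "eventually (\<lambda>k. T \<le> 1 * sqrt (real (n k)) * \<Psi> k - ?z) sequentially"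
    proof eventually_elim
      case (elim k)
      have "\<bar>T + ?z\<bar> \<le> \<Psi> k / sqrt (real (d k))" by (rule elim(1))
      also have "\<dots> \<le> \<Psi> k / 1"
        using elim(2) Psi_nonneg by (intro divide_left_mono) auto
      also have "\<dots> \<le> sqrt (real (n k)) * \<Psi> k"
        using elim(3) Psi_nonneg[of k] mult_right_mono[of 1 "sqrt (real (n k))" "\<Psi> k"] by simp
      finally show ?case by simp
    qed
  qed
  moreover have "(std_normal_cdf \<longlongrightarrow> 1) at_top"
    unfolding std_normal_cdf_def
    by (rule real_distribution.cdf_lim_at_top_prob[OF real_dist_normal_dist])
  ultimately have cdf: "(\<lambda>k. std_normal_cdf (1 * sqrt (real (n k)) * \<Psi> k - ?z)) \<longlonglongrightarrow> 1"
    by (rule filterlim_compose[rotated])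
  have "(\<lambda>k. ?power k - std_normal_cdf (1 * sqrt (real (n k)) * \<Psi> k - ?z)) \<longlonglongrightarrow> 0"
    using tendsto_diff[OF power cdf] by simp
  then show ?thesis
    using power by (intro conjI exI[of _ 1] exI[of _ "\<lambda>_. 1"]) auto
qed

end
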